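(* Let $\Gamma$ be a set and let $X$ be a (closed) subspace of $\ell_\infty^c(\Gamma)$ that is weakly Lindelöf determined (WLD). Then the following assertions are equivalent: (i) $X$ is separable; (ii) $X$ embeds into $\ell_\infty$ (isomorphically); (iii) there exists a bounded linear injection from $X$ into $\ell_\infty$; (iv) $X$ does not contain a subspace that is isomorphic to $c_0(\omega_1)$; (v) $X$ does not contain a subspace that is isometrically isomorphic to $c_0(\omega_1)$. In particular, every reflexive (closed) subspace of $\ell_\infty^c(\Gamma)$ is separable.
   Context: For a set $\Gamma$, $\ell_\infty^c(\Gamma)$ denotes the Banach space of all bounded scalar-valued functions on $\Gamma$ that are non-zero at no more than countably many points of $\Gamma$, with the supremum norm. $\ell_\infty$ is the space of bounded scalar sequences with the supremum norm, and $\omega_1$ is the first uncountable ordinal. $c_0(\omega_1)$ is the Banach space of scalar functions $f$ on $\omega_1$ such that $\{\alpha : |f(\alpha)|\geq \varepsilon\}$ is finite for every $\varepsilon>0$, with the supremum norm. Subspaces of Banach spaces are closed linear subspaces. A Banach space $X$ is weakly Lindelöf determined (WLD) if for some set $\Delta$ there exists an injective bounded linear operator $T\colon X^*\to \ell_\infty^c(\Delta)$ that is continuous as a map from $X^*$ with the weak* topology to $\ell_\infty^c(\Delta)$ with the topology of pointwise convergence. A Banach space $X$ embeds into a Banach space $Y$ if there is a bounded linear operator $T\colon X\to Y$ that is bounded below on the unit sphere of $X$ (i.e. there is $c>0$ with $\|Tx\|\geq c\|x\|$ for all $x\in X$); no isometry is required. *)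

theory Defs
  imports "HOL-Analysis.Analysis"
begin

text \<open>
  The scalar field is a type of sort \<open>{real_normed_field, euclidean_space}\<close>. The types
  \<open>real\<close> and \<open>complex\<close> have this sort, and by the Frobenius theorem every type of this sort is
  isometrically isomorphic, as a field, to one of them.

  Every normed space below consists of scalar functions on an index type with pointwise
  operations. A space of functions on a subset of the index type is represented by the functions
  that vanish off that subset, so that it is closed under the pointwise operations; the same
  convention turns the functionals on \<open>X\<close> into functions on the type of the vectors of \<open>X\<close>.
\<close>

record ('i, 'k) fspace =
  vecs :: "('i \<Rightarrow> 'k) set"
  vnorm :: "('i \<Rightarrow> 'k) \<Rightarrow> real"

definition sup_norm :: "('i \<Rightarrow> 'k::{real_normed_field, euclidean_space}) \<Rightarrow> real" where
  "sup_norm f = (SUP i. norm (f i))"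

definition linf_c :: "'i set \<Rightarrow> ('i, 'k::{real_normed_field, euclidean_space}) fspace" where
  "linf_c \<Gamma> = \<lparr>vecs = {f. (\<forall>i. i \<notin> \<Gamma> \<longrightarrow> f i = 0) \<and> bounded (range f) \<and> countable {i \<in> \<Gamma>. f i \<noteq> 0}},
               vnorm = sup_norm\<rparr>"

definition linf :: "(nat, 'k::{real_normed_field, euclidean_space}) fspace" where
  "linf = \<lparr>vecs = {f. bounded (range f)}, vnorm = sup_norm\<rparr>"

definition c0 :: "'i set \<Rightarrow> ('i, 'k::{real_normed_field, euclidean_space}) fspace" where
  "c0 \<Gamma> = \<lparr>vecs = {f. (\<forall>i. i \<notin> \<Gamma> \<longrightarrow> f i = 0) \<and> (\<forall>\<epsilon>>0. finite {i \<in> \<Gamma>. norm (f i) \<ge> \<epsilon>})},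
           vnorm = sup_norm\<rparr>"

text \<open>
  \<open>cardSuc natLeq\<close> is a well-order of the least order type among the uncountable ones; its field
  serves as the set of all ordinals below the first uncountable ordinal.
\<close>

definition omega1 :: "nat set set" where
  "omega1 = Field (cardSuc natLeq)"

text \<open>The distance is cut off outside \<open>X\<close> because \<open>Metric_space\<close> asks for symmetry and
  nonnegativity on the whole type.\<close>

definition norm_dist ::
  "('i, 'k::{real_normed_field, euclidean_space}) fspace \<Rightarrow> ('i \<Rightarrow> 'k) \<Rightarrow> ('i \<Rightarrow> 'k) \<Rightarrow> real" where
  "norm_dist X f g = (if f \<in> vecs X \<and> g \<in> vecs X then vnorm X (\<lambda>i. f i - g i) else 0)"

definition norm_topology ::
  "('i, 'k::{real_normed_field, euclidean_space}) fspace \<Rightarrow> ('i \<Rightarrow> 'k) topology" where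
  "norm_topology X = Metric_space.mtopology (vecs X) (norm_dist X)"

definition separable :: "('i, 'k::{real_normed_field, euclidean_space}) fspace \<Rightarrow> bool" where
  "separable X \<longleftrightarrow> separable_space (norm_topology X)"

definition closed_subspace ::
  "('i, 'k::{real_normed_field, euclidean_space}) fspace \<Rightarrow> ('i, 'k) fspace \<Rightarrow> bool" where
  "closed_subspace Y X \<longleftrightarrow>
     vnorm Y = vnorm X \<and> vecs Y \<subseteq> vecs X \<and>
     (\<lambda>i. 0) \<in> vecs Y \<and>
     (\<forall>f\<in>vecs Y. \<forall>g\<in>vecs Y. (\<lambda>i. f i + g i) \<in> vecs Y) \<and>
     (\<forall>c. \<forall>f\<in>vecs Y. (\<lambda>i. c * f i) \<in> vecs Y) \<and>
     closedin (norm_topology X) (vecs Y)"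

definition bounded_operator ::
  "('i, 'k::{real_normed_field, euclidean_space}) fspace \<Rightarrow> ('j, 'k) fspace
     \<Rightarrow> (('i \<Rightarrow> 'k) \<Rightarrow> ('j \<Rightarrow> 'k)) \<Rightarrow> bool" where
  "bounded_operator X Y T \<longleftrightarrow>
     T ` vecs X \<subseteq> vecs Y \<and>
     (\<forall>f\<in>vecs X. \<forall>g\<in>vecs X. T (\<lambda>i. f i + g i) = (\<lambda>j. T f j + T g j)) \<and>
     (\<forall>c. \<forall>f\<in>vecs X. T (\<lambda>i. c * f i) = (\<lambda>j. c * T f j)) \<and>
     (\<exists>C. \<forall>f\<in>vecs X. vnorm Y (T f) \<le> C * vnorm X f)"

definition embeds ::
  "('i, 'k::{real_normed_field, euclidean_space}) fspace \<Rightarrow> ('j, 'k) fspace \<Rightarrow> bool" where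
  "embeds X Y \<longleftrightarrow>
     (\<exists>T. bounded_operator X Y T \<and> (\<exists>c>0. \<forall>f\<in>vecs X. vnorm Y (T f) \<ge> c * vnorm X f))"

definition injects ::
  "('i, 'k::{real_normed_field, euclidean_space}) fspace \<Rightarrow> ('j, 'k) fspace \<Rightarrow> bool" where
  "injects X Y \<longleftrightarrow> (\<exists>T. bounded_operator X Y T \<and> inj_on T (vecs X))"

definition isomorphic ::
  "('i, 'k::{real_normed_field, euclidean_space}) fspace \<Rightarrow> ('j, 'k) fspace \<Rightarrow> bool" where
  "isomorphic X Y \<longleftrightarrow>
     (\<exists>T. bounded_operator X Y T \<and> bij_betw T (vecs X) (vecs Y) \<and>
          bounded_operator Y X (inv_into (vecs X) T))"

definition isometrically_isomorphic ::
  "('i, 'k::{real_normed_field, euclidean_space}) fspace \<Rightarrow> ('j, 'k) fspace \<Rightarrow> bool" where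
  "isometrically_isomorphic X Y \<longleftrightarrow>
     (\<exists>T. bounded_operator X Y T \<and> bij_betw T (vecs X) (vecs Y) \<and>
          (\<forall>f\<in>vecs X. vnorm Y (T f) = vnorm X f))"

definition dual_space ::
  "('i, 'k::{real_normed_field, euclidean_space}) fspace \<Rightarrow> ('i \<Rightarrow> 'k, 'k) fspace" where
  "dual_space X =
     \<lparr>vecs = {\<phi>. (\<forall>f. f \<notin> vecs X \<longrightarrow> \<phi> f = 0) \<and>
                 (\<forall>f\<in>vecs X. \<forall>g\<in>vecs X. \<phi> (\<lambda>i. f i + g i) = \<phi> f + \<phi> g) \<and>
                 (\<forall>c. \<forall>f\<in>vecs X. \<phi> (\<lambda>i. c * f i) = c * \<phi> f) \<and>
                 (\<exists>C. \<forall>f\<in>vecs X. norm (\<phi> f) \<le> C * vnorm X f)},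
      vnorm = (\<lambda>\<phi>. SUP f\<in>{f \<in> vecs X. vnorm X f \<le> 1}. norm (\<phi> f))\<rparr>"

text \<open>
  Function types carry the product topology, that is, the topology of pointwise convergence on the
  whole index type. Since the vectors of \<open>linf_c \<Delta>\<close> vanish off \<open>\<Delta>\<close> and the functionals in
  \<open>dual_space X\<close> vanish off \<open>X\<close>, the induced topology is that of pointwise convergence on \<open>\<Delta>\<close> in
  the first case, and on \<open>X\<close>, that is, the weak* topology, in the second.
\<close>

definition pointwise_topology ::
  "('i, 'k::{real_normed_field, euclidean_space}) fspace \<Rightarrow> ('i \<Rightarrow> 'k) topology" where
  "pointwise_topology X = top_of_set (vecs X)"

definition weak_star_topology ::
  "('i, 'k::{real_normed_field, euclidean_space}) fspace \<Rightarrow> (('i \<Rightarrow> 'k) \<Rightarrow> 'k) topology" where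
  "weak_star_topology X = top_of_set (vecs (dual_space X))"

text \<open>
  A definition cannot quantify existentially over the type in which \<open>\<Delta>\<close> lives, so this type is a
  parameter. As a hypothesis of a theorem, \<open>WLD TYPE('d) X\<close> with a type variable \<open>'d\<close> that does
  not occur elsewhere covers every set \<open>\<Delta>\<close>.
\<close>

definition WLD ::
  "'d itself \<Rightarrow> ('i, 'k::{real_normed_field, euclidean_space}) fspace \<Rightarrow> bool" where
  "WLD _ X \<longleftrightarrow>
     (\<exists>(\<Delta>::'d set) T.
        bounded_operator (dual_space X) (linf_c \<Delta>) T \<and>
        inj_on T (vecs (dual_space X)) \<and>
        continuous_map (weak_star_topology X) (pointwise_topology (linf_c \<Delta>)) T)"

definition canonical_map ::
  "('i, 'k::{real_normed_field, euclidean_space}) fspace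
     \<Rightarrow> ('i \<Rightarrow> 'k) \<Rightarrow> (('i \<Rightarrow> 'k) \<Rightarrow> 'k) \<Rightarrow> 'k" where
  "canonical_map X f = (\<lambda>\<phi>. if \<phi> \<in> vecs (dual_space X) then \<phi> f else 0)"

definition reflexive :: "('i, 'k::{real_normed_field, euclidean_space}) fspace \<Rightarrow> bool" where
  "reflexive X \<longleftrightarrow> canonical_map X ` vecs X = vecs (dual_space (dual_space X))"

end

theory Submission
  imports Defs "HOL-Library.Function_Algebras" "HOL-Library.Countable_Set_Type"
begin

text \<open>
  If \<open>X\<close> is WLD, the coordinates of the operator on the dual are evaluations at vectors \<open>x\<^sub>\<delta>\<close> of \<open>X\<close>,
  whose span is dense by the Hahn-Banach theorem. Each \<open>x\<^sub>\<delta>\<close> has countable support, and applying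
  the operator to the coordinate functionals shows that each point of \<open>\<Gamma>\<close> meets only countably many
  of these supports. Hence, if \<open>X\<close> is not separable, a maximal family of nonzero \<open>x\<^sub>\<delta>\<close> with pairwise
  disjoint supports is uncountable, and after normalisation it spans an isometric copy of
  \<open>c\<^sub>0(\<omega>\<^sub>1)\<close>. That space has no bounded injection into \<open>\<ell>\<^sub>\<infinity>\<close>, because a bounded functional on it is
  nonzero at only countably many unit vectors, whereas a separable \<open>X\<close> lives on a countable subset
  of \<open>\<Gamma>\<close>.

  If \<open>X\<close> is reflexive, bounded sequences have weak cluster points. When restriction to some countable
  set of coordinates is injective on \<open>X\<close>, this makes \<open>X\<close> separable. Otherwise there are normalised
  vectors with pairwise disjoint supports; their partial sums are bounded and cluster weakly at a
  vector of distance at least 1 from the span of the sequence, contradicting Hahn-Banach.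
\<close>

section \<open>The Hahn-Banach theorem\<close>

locale real_subspace = vector_space scale
  for scale :: "real \<Rightarrow> 'b::ab_group_add \<Rightarrow> 'b" (infixr \<open>\<odot>\<close> 75) +
  fixes V :: "'b set"
  assumes subspace_V: "subspace V"
begin

text \<open>Only one half of positive homogeneity is demanded, which is easy to check for infima;
  scaling back by \<open>1 / r\<close> recovers equality in \<open>sublinear_scale\<close>.\<close>

definition sublinear :: "('b \<Rightarrow> real) \<Rightarrow> bool" where
  "sublinear q \<longleftrightarrow> q 0 = 0 \<and> (\<forall>x\<in>V. \<forall>y\<in>V. q (x + y) \<le> q x + q y) \<and>
     (\<forall>r>0. \<forall>x\<in>V. q (r \<odot> x) \<le> r * q x)"

lemma V_closed [simp]:
  "0 \<in> V" "x \<in> V \<Longrightarrow> y \<in> V \<Longrightarrow> x + y \<in> V" "x \<in> V \<Longrightarrow> r \<odot> x \<in> V" "x \<in> V \<Longrightarrow> - x \<in> V"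
  using subspace_V by (auto intro: subspace_0 subspace_add subspace_scale subspace_neg)

lemma sublinear_scale:
  assumes "sublinear q" "r \<ge> 0" "x \<in> V"
  shows "q (r \<odot> x) = r * q x"
proof (cases "r = 0")
  case True
  then show ?thesis using assms by (simp add: sublinear_def)
next
  case False
  with assms have r: "r > 0" by simp
  have "q ((1 / r) \<odot> r \<odot> x) \<le> (1 / r) * q (r \<odot> x)"
    using assms r unfolding sublinear_def by (meson V_closed(3) zero_less_divide_1_iff)
  then have "r * q x \<le> q (r \<odot> x)"
    using r by (simp add: field_simps)
  moreover have "q (r \<odot> x) \<le> r * q x"
    using assms r by (simp add: sublinear_def)
  ultimately show ?thesis by simp
qed

lemma sublinear_ge_uminus:
  assumes "sublinear q" "x \<in> V"
  shows "- q (- x) \<le> q x"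
proof -
  have "q (x + - x) \<le> q x + q (- x)"
    using assms V_closed(4) unfolding sublinear_def by blast
  then show ?thesis using assms by (simp add: sublinear_def)
qed

text \<open>Lowering \<open>q\<close> as far as possible in the direction \<open>-x\<close>; a minimal sublinear functional is a
  fixed point of this construction for every \<open>x\<close>, hence odd, hence linear.\<close>

lemma sublinear_lower:
  assumes q: "sublinear q" and x: "x \<in> V"
  obtains q' where "sublinear q'" "\<And>z. z \<in> V \<Longrightarrow> q' z \<le> q z" "\<And>z. z \<notin> V \<Longrightarrow> q' z = 0"
    "q' (- x) \<le> - q x"
proof
  \<comment> \<open>\<open>h z t\<close> compares \<open>q\<close> at \<open>z + t \<odot> x\<close>
    with the most that moving by \<open>t \<odot> x\<close> can add. The choice \<open>t = 0\<close>
    gives \<open>q' \<le> q\<close>, and \<open>t = 1\<close> at \<open>- x\<close> gives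
    \<open>q' (- x) \<le> - q x\<close>.\<close>
  define h where "h z t = q (z + t \<odot> x) - t * q x" for z t
  define q' where "q' z = (if z \<in> V then INF t\<in>{0..}. h z t else 0)" for z
  have sub: "q (a + b) \<le> q a + q b" if "a \<in> V" "b \<in> V" for a b
    using q that by (simp add: sublinear_def)
  \<comment> \<open>A bound independent of \<open>t\<close>, so that the infimum exists:
    \<open>t * q x = q (t \<odot> x)\<close> is at most
    \<open>q (z + t \<odot> x) + q (- z)\<close>.\<close>
  have lower: "- q (- z) \<le> h z t" if "z \<in> V" "t \<ge> 0" for z t
    using sub[of "z + t \<odot> x" "- z"] sublinear_scale[OF q that(2) x] that x by (simp add: h_def)
  have le: "q' z \<le> h z t" if "z \<in> V" "t \<ge> 0" for z t
    using that lower unfolding q'_def by (auto intro!: cINF_lower bdd_belowI2)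
  have ge: "m \<le> q' z" if "z \<in> V" "\<And>t. t \<ge> 0 \<Longrightarrow> m \<le> h z t" for z m
    using that unfolding q'_def by (auto intro!: cINF_greatest)
  show "q' z = 0" if "z \<notin> V" for z using that by (simp add: q'_def)
  show "q' z \<le> q z" if "z \<in> V" for z using le[OF that, of 0] by (simp add: h_def)
  show "q' (- x) \<le> - q x"
    using le[of "- x" 1] x q by (simp add: h_def sublinear_def)
  show "sublinear q'"
    unfolding sublinear_def
  proof (intro conjI ballI allI impI)
    have "h 0 t = 0" if "t \<ge> 0" for t
      using sublinear_scale[OF q that x] by (simp add: h_def)
    then show "q' 0 = 0"
      using le[of 0 0] ge[of 0 0] by fastforce
  next
    fix a b assume ab: "a \<in> V" "b \<in> V"
    have "q' (a + b) - h b u \<le> h a t" if "t \<ge> 0" "u \<ge> 0" for t u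
    proof -
      have "h (a + b) (t + u) \<le> h a t + h b u"
        using sub[of "a + t \<odot> x" "b + u \<odot> x"] ab x
        by (simp add: h_def scale_left_distrib algebra_simps)
      then show ?thesis using le[of "a + b" "t + u"] that ab by simp
    qed
    then have "q' (a + b) - q' a \<le> h b u" if "u \<ge> 0" for u
      using ge[OF ab(1), of "q' (a + b) - h b u"] that by force
    then show "q' (a + b) \<le> q' a + q' b"
      using ge[OF ab(2), of "q' (a + b) - q' a"] by force
  next
    fix r :: real and z assume r: "0 < r" and z: "z \<in> V"
    have "q' (r \<odot> z) / r \<le> h z t" if "t \<ge> 0" for t
    proof -
      have "h (r \<odot> z) (r * t) = q (r \<odot> (z + t \<odot> x)) - r * t * q x"
        by (simp add: h_def scale_right_distrib)
      also have "\<dots> = r * h z t"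
        using sublinear_scale[OF q, of r "z + t \<odot> x"] r z x by (simp add: h_def algebra_simps)
      finally show ?thesis
        using le[of "r \<odot> z" "r * t"] r z that by (simp add: field_simps)
    qed
    then have "q' (r \<odot> z) / r \<le> q' z" using ge z by blast
    then show "q' (r \<odot> z) \<le> r * q' z" using r by (simp add: field_simps)
  qed
qed

text \<open>The infimum is finite because sublinearity and \<open>q \<le> p\<close> on
  \<open>V\<close> give \<open>- p (- x) \<le> q x\<close>. It is subadditive because two members of
  a chain, one chosen for each summand, can both be replaced by the smaller of them.\<close>

lemma sublinear_INF_chain:
  assumes C: "C \<noteq> {}" "\<And>q. q \<in> C \<Longrightarrow> sublinear q"
    and chain: "\<And>q q'. q \<in> C \<Longrightarrow> q' \<in> C \<Longrightarrow> q \<le> q' \<or> q' \<le> q"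
    and p: "\<And>q x. q \<in> C \<Longrightarrow> x \<in> V \<Longrightarrow> q x \<le> p x"
    and off: "\<And>q x. q \<in> C \<Longrightarrow> x \<notin> V \<Longrightarrow> q x = 0"
  shows "sublinear (\<lambda>x. INF q\<in>C. q x)" and "\<And>q. q \<in> C \<Longrightarrow> (\<lambda>x. INF q\<in>C. q x) \<le> q"
proof -
  define u where "u x = (INF q\<in>C. q x)" for x
  have low: "- p (- x) \<le> q x" if "q \<in> C" "x \<in> V" for q x
    using sublinear_ge_uminus[OF C(2)[OF that(1)] that(2)] p[OF that(1), of "- x"] that(2) by simp
  have le: "u x \<le> q x" if "q \<in> C" for q x
  proof (cases "x \<in> V")
    case True
    then show ?thesis unfolding u_def using that low by (auto intro!: cINF_lower bdd_belowI2)
  next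
    case False
    then show ?thesis unfolding u_def using that off[OF _ False]
      by (intro cINF_lower bdd_belowI2[of _ 0]) (simp_all, metis order_refl)
  qed
  have ge: "m \<le> u x" if "\<And>q. q \<in> C \<Longrightarrow> m \<le> q x" for m x
    unfolding u_def using that C(1) by (intro cINF_greatest) auto
  have "sublinear u"
    unfolding sublinear_def
  proof (intro conjI ballI allI impI)
    have z: "q 0 = 0" if "q \<in> C" for q
      using C(2)[OF that] by (simp add: sublinear_def)
    obtain q where q: "q \<in> C" using C(1) by auto
    have "u 0 \<le> 0" using le[OF q, of 0] z[OF q] by linarith
    moreover have "0 \<le> u 0" by (rule ge) (metis z order_refl)
    ultimately show "u 0 = 0" by simp
  next
    fix a b assume ab: "a \<in> V" "b \<in> V"
    have *: "u (a + b) - q' b \<le> q a" if "q \<in> C" "q' \<in> C" for q q'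
    proof -
      obtain q'' where q'': "q'' \<in> C" "q'' \<le> q" "q'' \<le> q'"
        using chain[OF \<open>q \<in> C\<close> \<open>q' \<in> C\<close>] \<open>q \<in> C\<close> \<open>q' \<in> C\<close> by blast
      have "u (a + b) \<le> q'' a + q'' b"
        using le[OF q''(1), of "a + b"] C(2)[OF q''(1)] ab unfolding sublinear_def
        by (meson order_trans)
      then show ?thesis using le_funD[OF q''(2), of a] le_funD[OF q''(3), of b] by linarith
    qed
    have "u (a + b) - u a \<le> q' b" if "q' \<in> C" for q'
    proof -
      have "u (a + b) - q' b \<le> u a" by (rule ge) (rule *[OF _ that])
      then show ?thesis by linarith
    qed
    then have "u (a + b) - u a \<le> u b" by (rule ge)
    then show "u (a + b) \<le> u a + u b" by linarith
  next
    fix r :: real and z assume r: "0 < r" and z: "z \<in> V"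
    have "u (r \<odot> z) / r \<le> q z" if "q \<in> C" for q
      using le[OF that, of "r \<odot> z"] sublinear_scale[OF C(2)[OF that], of r z] r z
      by (simp add: field_simps)
    then have "u (r \<odot> z) / r \<le> u z" by (rule ge)
    then show "u (r \<odot> z) \<le> r * u z" using r by (simp add: field_simps)
  qed
  then show "sublinear (\<lambda>x. INF q\<in>C. q x)" by (simp add: u_def[abs_def])
  show "(\<lambda>x. INF q\<in>C. q x) \<le> q" if "q \<in> C" for q
    using le[OF that] by (simp add: u_def le_fun_def)
qed

text \<open>Zorn's lemma is applied below \<open>p0\<close>, which is \<open>p\<close> already
  lowered towards \<open>- y\<close>. A minimal functional is odd, and oddness turns subadditivity
  into additivity. Since its value at \<open>- y\<close> is at most \<open>- p y\<close>, oddness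
  also yields the value \<open>p y\<close> at \<open>y\<close>.\<close>

theorem hahn_banach_sublinear:
  assumes p: "sublinear p" and y: "y \<in> V"
  obtains u where "\<And>x z. x \<in> V \<Longrightarrow> z \<in> V \<Longrightarrow> u (x + z) = u x + u z"
    "\<And>r x. x \<in> V \<Longrightarrow> u (r \<odot> x) = r * u x" "\<And>x. x \<in> V \<Longrightarrow> u x \<le> p x" "u y = p y"
proof -
  obtain p0 where p0: "sublinear p0" "\<And>z. z \<in> V \<Longrightarrow> p0 z \<le> p z" "\<And>z. z \<notin> V \<Longrightarrow> p0 z = 0"
    "p0 (- y) \<le> - p y"
    using sublinear_lower[OF p y] by blast
  \<comment> \<open>Vanishing off \<open>V\<close> makes the pointwise order on the whole type agree
    with the order on \<open>V\<close>, so that minimality yields equality of functions.\<close>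
  define A where "A = {q. sublinear q \<and> q \<le> p0 \<and> (\<forall>z. z \<notin> V \<longrightarrow> q z = 0)}"
  have "\<exists>m\<in>A. \<forall>a\<in>A. m \<ge> a \<longrightarrow> a = m"
  proof (rule predicate_Zorn)
    show "partial_order_on A (relation_of (\<lambda>x y. x \<ge> y) A)"
      by (rule partial_order_on_relation_ofI) auto
  next
    fix C assume "C \<in> Chains (relation_of (\<lambda>x y. x \<ge> y) A)"
    then have C: "C \<subseteq> A" "\<And>q q'. q \<in> C \<Longrightarrow> q' \<in> C \<Longrightarrow> q \<le> q' \<or> q' \<le> q"
      by (auto simp: Chains_def relation_of_def)
    show "\<exists>u\<in>A. \<forall>a\<in>C. a \<ge> u"
    proof (cases "C = {}")
      case True
      then show ?thesis using p0 by (auto simp: A_def)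
    next
      case False
      let ?u = "\<lambda>x. INF q\<in>C. q x"
      have A: "sublinear q" "q x \<le> p0 x" "z \<notin> V \<Longrightarrow> q z = 0" if "q \<in> C" for q x z
        using that C(1) by (auto simp: A_def le_fun_def)
      have u: "sublinear ?u" "q \<in> C \<Longrightarrow> ?u \<le> q" for q
        using sublinear_INF_chain[of C p0] False A C(2) by blast+
      obtain q where q: "q \<in> C" using False by blast
      have "?u z = 0" if "z \<notin> V" for z
        using A(3)[OF _ that] False by (metis (mono_tags, lifting) cINF_const INF_cong)
      moreover have "?u \<le> p0" using u(2)[OF q] A(2)[OF q] by (meson le_funI le_funD order_trans)
      ultimately have "?u \<in> A" using u(1) by (auto simp: A_def)
      then show ?thesis using u(2) by blast
    qed
  qed
  then obtain m where m: "m \<in> A" and min: "\<And>a. a \<in> A \<Longrightarrow> a \<le> m \<Longrightarrow> a = m" by blast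
  have sm: "sublinear m" using m by (simp add: A_def)
  have odd: "m (- x) = - m x" if x: "x \<in> V" for x
  proof -
    obtain q where q: "sublinear q" "\<And>z. z \<in> V \<Longrightarrow> q z \<le> m z" "\<And>z. z \<notin> V \<Longrightarrow> q z = 0"
      "q (- x) \<le> - m x"
      using sublinear_lower[OF sm x] by blast
    have "q z \<le> m z" for z
      using q(2,3) m by (cases "z \<in> V") (auto simp: A_def)
    then have "q \<le> m" by (rule le_funI)
    moreover from this have "q \<in> A" using q m by (auto simp: A_def)
    ultimately have "q = m" using min by blast
    then show ?thesis using q(4) sublinear_ge_uminus[OF sm x] by simp
  qed
  show thesis
  proof
    show add: "m (x + z) = m x + m z" if "x \<in> V" "z \<in> V" for x z
    proof -
      have "m (x + z) \<le> m x + m z" using sm that by (simp add: sublinear_def)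
      moreover have "m (- x + - z) \<le> m (- x) + m (- z)"
        using sm that V_closed(4) unfolding sublinear_def by blast
      ultimately show ?thesis using odd[of "x + z"] odd[of x] odd[of z] that
        by (simp add: add.commute)
    qed
    show "m (r \<odot> x) = r * m x" if "x \<in> V" for r x
    proof (cases "r \<ge> 0")
      case True
      then show ?thesis using sublinear_scale sm that by blast
    next
      case False
      then have "m ((- r) \<odot> x) = - r * m x" using sublinear_scale[OF sm, of "- r" x] that by simp
      then show ?thesis using odd[of "r \<odot> x"] that by simp
    qed
    show mp: "m x \<le> p x" if "x \<in> V" for x
      using p0(2)[OF that] m that by (auto simp: A_def le_fun_def intro: order_trans)
    have "m (- y) \<le> - p y" using p0(4) m y by (auto simp: A_def le_fun_def intro: order_trans)
    then show "m y = p y" using mp[OF y] odd[OF y] by simp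
  qed
qed

end

text \<open>This replaces the usual passage from real to complex functionals and needs no case distinction on
  the scalar field.\<close>

lemma real_functional_on_field:
  fixes v :: "'k::{real_normed_field, euclidean_space} \<Rightarrow> real"
  assumes add: "\<And>c d. v (c + d) = v c + v d" and scale: "\<And>r c. v (r *\<^sub>R c) = r * v c"
  obtains a where "\<And>c. (c * a) \<bullet> 1 = v c"
proof -
  \<comment> \<open>\<open>g a\<close> is the vector that represents the real functional
    \<open>c \<mapsto> (c * a) \<bullet> 1\<close> in the inner product. Inverses in the field make
    \<open>g\<close> injective, and finite dimension then makes it surjective.\<close>
  define g :: "'k \<Rightarrow> 'k" where "g a = (\<Sum>b\<in>Basis. ((b * a) \<bullet> 1) *\<^sub>R b)" for a
  have rep: "c = (\<Sum>b\<in>Basis. (c \<bullet> b) *\<^sub>R b)" for c :: 'k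
    by (simp add: euclidean_representation)
  have lin: "linear g"
    by (rule linearI) (simp_all add: g_def algebra_simps inner_add_left sum.distrib scaleR_sum_right)
  have eq: "(c * a) \<bullet> 1 = c \<bullet> g a" for c a
  proof -
    have "(c * a) \<bullet> 1 = ((\<Sum>b\<in>Basis. (c \<bullet> b) *\<^sub>R b) * a) \<bullet> 1"
      by (simp add: euclidean_representation)
    also have "\<dots> = c \<bullet> g a"
      by (simp add: g_def sum_distrib_right inner_sum_left inner_sum_right mult.commute[of "_ \<bullet> 1"])
    finally show ?thesis .
  qed
  have "a = 0" if "g a = 0" for a
  proof (rule ccontr)
    assume "a \<noteq> 0"
    then have "(1::'k) \<bullet> 1 = 0" using eq[of "inverse a" a] that by simp
    then show False by simp
  qed
  then have "inj g" using lin by (simp add: linear_injective_0)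
  then have "surj g" using lin by (simp add: linear_injective_imp_surjective)
  then obtain a where a: "g a = (\<Sum>b\<in>Basis. v b *\<^sub>R b)" by (metis surjD)
  have v0: "v 0 = 0" using scale[of 0 0] by simp
  have vsum: "v (sum f S) = (\<Sum>b\<in>S. v (f b))" for f :: "'k \<Rightarrow> 'k" and S
    by (induction S rule: infinite_finite_induct) (auto simp: v0 add)
  have "(c * a) \<bullet> 1 = v c" for c
  proof -
    have "v c = (\<Sum>b\<in>Basis. (c \<bullet> b) * v b)"
      by (subst rep) (simp add: vsum scale)
    then show ?thesis unfolding eq a by (simp add: inner_sum_right mult.commute)
  qed
  then show thesis using that by blast
qed

text \<open>For each \<open>x\<close> the real functional \<open>c \<mapsto> u (s c x)\<close> on
  the field is represented by a unique scalar, and that scalar is taken as \<open>\<phi> x\<close>.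
  Uniqueness carries linearity over from \<open>u\<close> to \<open>\<phi>\<close>, and
  \<open>u\<close> is recovered as the component of \<open>\<phi>\<close> along 1.\<close>

theorem hahn_banach_seminorm:
  fixes s :: "'k::{real_normed_field, euclidean_space} \<Rightarrow> 'b::ab_group_add \<Rightarrow> 'b"
  assumes "vector_space s" and V: "module.subspace s V" and y: "y \<in> V"
    and p_add: "\<And>x z. x \<in> V \<Longrightarrow> z \<in> V \<Longrightarrow> p (x + z) \<le> p x + p z"
    and p_scale: "\<And>c x. x \<in> V \<Longrightarrow> p (s c x) \<le> norm c * p x"
  obtains \<phi> :: "'b \<Rightarrow> 'k" where "\<And>x z. x \<in> V \<Longrightarrow> z \<in> V \<Longrightarrow> \<phi> (x + z) = \<phi> x + \<phi> z"
    "\<And>c x. x \<in> V \<Longrightarrow> \<phi> (s c x) = c * \<phi> x" "\<And>x. x \<in> V \<Longrightarrow> norm (\<phi> x) \<le> p x"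
    "\<phi> y \<bullet> 1 = p y"
proof -
  interpret K: vector_space s by fact
  \<comment> \<open>The scalars are restricted to the reals; the locale takes the scalar action as a
    parameter for this purpose.\<close>
  interpret real_subspace "\<lambda>r. s (of_real r)" V
  proof (unfold_locales)
    have R: "module (\<lambda>r::real. s (of_real r))"
      by unfold_locales (simp_all add: K.scale_right_distrib K.scale_left_distrib)
    show "module.subspace (\<lambda>r::real. s (of_real r)) V"
      using V by (simp add: module.subspace_def[OF R] K.subspace_def)
  qed (simp_all add: K.scale_right_distrib K.scale_left_distrib)
  have sV: "s c x \<in> V" if "x \<in> V" for c x
    using that V by (rule K.subspace_scale[rotated])
  have p0: "p 0 = 0"
  proof -
    have "p (s 0 0) \<le> norm (0::'k) * p 0" by (rule p_scale) simp
    moreover have "p (0 + 0) \<le> p 0 + p 0" by (rule p_add) simp_all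
    ultimately show ?thesis by simp
  qed
  have "sublinear p"
    unfolding sublinear_def
  proof (intro conjI ballI allI impI)
    show "p (s (of_real r) x) \<le> r * p x" if "0 < r" "x \<in> V" for r x
      using p_scale[OF that(2), of "of_real r"] that(1) by simp
  qed (use p0 p_add in auto)
  from hahn_banach_sublinear[OF this y] obtain u
    where u: "\<And>x z. x \<in> V \<Longrightarrow> z \<in> V \<Longrightarrow> u (x + z) = u x + u z"
      "\<And>r x. x \<in> V \<Longrightarrow> u (s (of_real r) x) = r * u x" "\<And>x. x \<in> V \<Longrightarrow> u x \<le> p x" "u y = p y"
    by blast
  have "\<exists>a. \<forall>c. (c * a) \<bullet> 1 = u (s c x)" if x: "x \<in> V" for x
  proof -
    have "u (s (c + d) x) = u (s c x) + u (s d x)" for c d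
      by (simp add: K.scale_left_distrib u(1) sV x)
    moreover have "u (s (r *\<^sub>R c) x) = r * u (s c x)" for r c
      using u(2)[OF sV[OF x], of r c] by (simp add: scaleR_conv_of_real)
    ultimately show ?thesis using real_functional_on_field[of "\<lambda>c. u (s c x)"] by metis
  qed
  then obtain \<phi> where \<phi>: "\<And>x c. x \<in> V \<Longrightarrow> (c * \<phi> x) \<bullet> 1 = u (s c x)" by metis
  \<comment> \<open>The pairing of \<open>c\<close> and \<open>a\<close> by
    \<open>(c * a) \<bullet> 1\<close> is nondegenerate: the inverse of a nonzero difference detects
    it.\<close>
  have uniq: "a = b" if "\<And>c. (c * a) \<bullet> 1 = (c * b) \<bullet> 1" for a b :: 'k
  proof (rule ccontr)
    assume "a \<noteq> b"
    have "(c * (a - b)) \<bullet> 1 = 0" for c using that[of c] by (simp add: right_diff_distrib inner_diff_left)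
    from this[of "inverse (a - b)"] show False using \<open>a \<noteq> b\<close> by simp
  qed
  show thesis
  proof
    show "\<phi> (x + z) = \<phi> x + \<phi> z" if "x \<in> V" "z \<in> V" for x z
      by (rule uniq) (simp add: \<phi> u(1) sV that K.scale_right_distrib distrib_left inner_add_left)
    show "\<phi> (s c x) = c * \<phi> x" if "x \<in> V" for c x
    proof (rule uniq)
      show "(d * \<phi> (s c x)) \<bullet> 1 = (d * (c * \<phi> x)) \<bullet> 1" for d
        using \<phi>[OF that, of "d * c"] \<phi>[OF sV[OF that], of d c] by (simp add: mult.assoc)
    qed
    show "norm (\<phi> x) \<le> p x" if x: "x \<in> V" for x
    proof (cases "\<phi> x = 0")
      case True
      \<comment> \<open>Here only \<open>0 \<le> p x\<close> is at stake, which follows from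
        \<open>0 = p (x - x) \<le> 2 * p x\<close>.\<close>
      have "p (s (- 1) x) \<le> norm (- 1 :: 'k) * p x" by (rule p_scale[OF x])
      moreover have "p (x + s (- 1) x) \<le> p x + p (s (- 1) x)" by (rule p_add[OF x sV[OF x]])
      ultimately show ?thesis using True p0 by simp
    next
      case False
      have "(1::'k) \<bullet> 1 = 1" using norm_eq_1[of "1::'k"] by simp
      \<comment> \<open>Rescaling \<open>x\<close> by \<open>inverse (\<phi> x)\<close> moves the
        value of \<open>\<phi>\<close> to 1, where the component along 1 is the full norm; the real
        bound on \<open>u\<close> thus becomes a bound on \<open>norm (\<phi> x)\<close>.\<close>
      then have "1 = u (s (inverse (\<phi> x)) x)" using \<phi>[OF x, of "inverse (\<phi> x)"] False by simp
      also have "\<dots> \<le> norm (inverse (\<phi> x)) * p x"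
        using u(3) p_scale sV x by (meson order_trans)
      finally have "norm (\<phi> x) * 1 \<le> norm (\<phi> x) * (inverse (norm (\<phi> x)) * p x)"
        by (intro mult_left_mono) (simp_all add: norm_inverse)
      then show ?thesis using False by (simp add: mult.assoc[symmetric])
    qed
    show "\<phi> y \<bullet> 1 = p y" using \<phi>[OF y, of 1] u(4) by simp
  qed
qed

section \<open>Spaces of bounded functions with the supremum norm\<close>

lemma norm_le_sup_norm: "bounded (range f) \<Longrightarrow> norm (f i) \<le> sup_norm f"
  unfolding sup_norm_def by (rule cSUP_upper) (auto simp: bdd_above_norm image_image[symmetric])

lemma sup_norm_le: "(\<And>i. norm (f i) \<le> C) \<Longrightarrow> sup_norm f \<le> C"
  unfolding sup_norm_def by (rule cSUP_least) auto

lemma sup_norm_nonneg: "bounded (range f) \<Longrightarrow> 0 \<le> sup_norm f"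
  by (rule order_trans[OF norm_ge_zero norm_le_sup_norm])

lemma bounded_rangeI: "(\<And>i. norm (f i) \<le> C) \<Longrightarrow> bounded (range f)"
  by (auto simp: bounded_iff)

lemma bounded_range_add:
  "bounded (range f) \<Longrightarrow> bounded (range g) \<Longrightarrow> bounded (range (\<lambda>i. f i + g i))"
  for f g :: "'i \<Rightarrow> 'k::{real_normed_field, euclidean_space}"
  by (rule bounded_rangeI[where C = "sup_norm f + sup_norm g"])
    (intro order_trans[OF norm_triangle_ineq] add_mono norm_le_sup_norm)

lemma bounded_range_diff:
  "bounded (range f) \<Longrightarrow> bounded (range g) \<Longrightarrow> bounded (range (\<lambda>i. f i - g i))"
  for f g :: "'i \<Rightarrow> 'k::{real_normed_field, euclidean_space}"
  by (rule bounded_rangeI[where C = "sup_norm f + sup_norm g"])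
    (intro order_trans[OF norm_triangle_ineq4] add_mono norm_le_sup_norm)

lemma bounded_range_cmult: "bounded (range f) \<Longrightarrow> bounded (range (\<lambda>i. c * f i))"
  for f :: "'i \<Rightarrow> 'k::{real_normed_field, euclidean_space}"
  using norm_le_sup_norm[of f]
  by (intro bounded_rangeI[where C = "norm c * sup_norm f"]) (simp add: norm_mult mult_left_mono)

lemma sup_norm_add:
  "bounded (range f) \<Longrightarrow> bounded (range g) \<Longrightarrow> sup_norm (\<lambda>i. f i + g i) \<le> sup_norm f + sup_norm g"
  by (intro sup_norm_le order_trans[OF norm_triangle_ineq] add_mono norm_le_sup_norm)

lemma sup_norm_triangle:
  assumes "bounded (range f)" "bounded (range g)" "bounded (range h)"
  shows "sup_norm (\<lambda>i. f i - h i) \<le> sup_norm (\<lambda>i. f i - g i) + sup_norm (\<lambda>i. g i - h i)"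
  using sup_norm_add[OF bounded_range_diff[OF assms(1,2)] bounded_range_diff[OF assms(2,3)]] by simp

lemma sup_norm_cmult_le: "bounded (range f) \<Longrightarrow> sup_norm (\<lambda>i. c * f i) \<le> norm c * sup_norm f"
  by (rule sup_norm_le) (simp add: norm_mult mult_left_mono norm_le_sup_norm)

lemma sup_norm_cmult:
  assumes "bounded (range f)"
  shows "sup_norm (\<lambda>i. c * f i) = norm c * sup_norm f"
proof (cases "c = 0")
  case True
  then show ?thesis by (simp add: sup_norm_def)
next
  case False
  have "sup_norm (\<lambda>i. inverse c * (c * f i)) \<le> norm (inverse c) * sup_norm (\<lambda>i. c * f i)"
    by (intro sup_norm_cmult_le bounded_range_cmult assms)
  then have "sup_norm f \<le> sup_norm (\<lambda>i. c * f i) / norm c"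
    using False by (simp add: mult.assoc[symmetric] norm_inverse divide_inverse mult.commute)
  then have "norm c * sup_norm f \<le> sup_norm (\<lambda>i. c * f i)"
    using False by (simp add: pos_le_divide_eq mult.commute)
  then show ?thesis using sup_norm_cmult_le[OF assms, of c] by simp
qed

lemma sup_norm_minus_commute: "sup_norm (\<lambda>i. f i - g i) = sup_norm (\<lambda>i. g i - f i)"
  by (simp add: sup_norm_def norm_minus_commute)

lemma sup_norm_eq_0: "bounded (range f) \<Longrightarrow> sup_norm f = 0 \<longleftrightarrow> f = (\<lambda>i. 0)"
  using norm_le_sup_norm[of f] by (auto simp: sup_norm_def fun_eq_iff)

section \<open>Closedness and separability expressed by approximation in the supremum norm\<close>

lemma Metric_space_sup_norm:
  assumes "vnorm X = sup_norm" "\<And>f. f \<in> vecs X \<Longrightarrow> bounded (range f)"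
  shows "Metric_space (vecs X) (norm_dist X)"
proof
  fix f g h
  show "0 \<le> norm_dist X f g"
    using assms by (auto simp: norm_dist_def intro!: sup_norm_nonneg bounded_range_diff)
  show "norm_dist X f g = norm_dist X g f"
    using assms by (simp add: norm_dist_def sup_norm_minus_commute[of f g])
  assume f: "f \<in> vecs X" and g: "g \<in> vecs X"
  then show "norm_dist X f g = 0 \<longleftrightarrow> f = g"
    using assms sup_norm_eq_0[OF bounded_range_diff, of f g] by (auto simp: norm_dist_def fun_eq_iff)
  assume h: "h \<in> vecs X"
  show "norm_dist X f h \<le> norm_dist X f g + norm_dist X g h"
    using f g h assms by (simp add: norm_dist_def sup_norm_triangle)
qed

lemma closedin_norm_topology_iff:
  assumes "vnorm X = sup_norm" "\<And>f. f \<in> vecs X \<Longrightarrow> bounded (range f)"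
  shows "closedin (norm_topology X) C \<longleftrightarrow> C \<subseteq> vecs X \<and>
    (\<forall>f\<in>vecs X. (\<forall>\<epsilon>>0. \<exists>g\<in>C. sup_norm (\<lambda>i. f i - g i) < \<epsilon>) \<longrightarrow> f \<in> C)"
proof -
  interpret Metric_space "vecs X" "norm_dist X" by (rule Metric_space_sup_norm[OF assms])
  have *: "disjnt C (mball f r) \<longleftrightarrow> \<not> (\<exists>g\<in>C. sup_norm (\<lambda>i. f i - g i) < r)"
    if "C \<subseteq> vecs X" "f \<in> vecs X" for f r
    using that by (force simp: disjnt_iff norm_dist_def assms(1))
  show ?thesis unfolding norm_topology_def closedin_metric using * by blast
qed

lemma separable_iff:
  assumes "vnorm X = sup_norm" "\<And>f. f \<in> vecs X \<Longrightarrow> bounded (range f)"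
  shows "separable X \<longleftrightarrow> (\<exists>C. countable C \<and> C \<subseteq> vecs X \<and>
    (\<forall>f\<in>vecs X. \<forall>\<epsilon>>0. \<exists>g\<in>C. sup_norm (\<lambda>i. f i - g i) < \<epsilon>))"
proof -
  interpret Metric_space "vecs X" "norm_dist X" by (rule Metric_space_sup_norm[OF assms])
  have *: "mtopology closure_of C = vecs X \<longleftrightarrow>
      (\<forall>f\<in>vecs X. \<forall>\<epsilon>>0. \<exists>g\<in>C. sup_norm (\<lambda>i. f i - g i) < \<epsilon>)" if "C \<subseteq> vecs X" for C
    unfolding metric_closure_of using that by (force simp: norm_dist_def assms(1))
  show ?thesis unfolding separable_def separable_space_def norm_topology_def using * by auto
qed

text \<open>Finite linear combinations of \<open>D\<close> with coefficients from \<open>Q\<close>.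
  A countable dense \<open>Q\<close> keeps the set countable without changing the closure, while
  \<open>Q = UNIV\<close> gives the linear span.\<close>

inductive_set combos :: "'k::{real_normed_field, euclidean_space} set \<Rightarrow> ('i \<Rightarrow> 'k) set \<Rightarrow> ('i \<Rightarrow> 'k) set"
  for Q D where
  combos_zero: "(\<lambda>i. 0) \<in> combos Q D"
| combos_step: "q \<in> Q \<Longrightarrow> d \<in> D \<Longrightarrow> c \<in> combos Q D \<Longrightarrow> (\<lambda>i. q * d i + c i) \<in> combos Q D"

lemma combos_add:
  "c \<in> combos Q D \<Longrightarrow> c' \<in> combos Q D \<Longrightarrow> (\<lambda>i. c i + c' i) \<in> combos Q D"
  by (induction rule: combos.induct) (auto simp: add.assoc intro: combos_step)

lemma countable_combos:
  assumes "countable Q" "countable D"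
  shows "countable (combos Q D)"
proof -
  let ?F = "\<lambda>l. foldr (\<lambda>(q, d) c. (\<lambda>i. q * d i + c i)) l (\<lambda>i. 0)"
  have "c \<in> ?F ` lists (Q \<times> D)" if "c \<in> combos Q D" for c
    using that
  proof induction
    case combos_zero
    show ?case by (rule image_eqI[of _ _ "[]"]) auto
  next
    case (combos_step q d c)
    then obtain l where "l \<in> lists (Q \<times> D)" "c = ?F l" by blast
    then show ?case using combos_step by (intro image_eqI[of _ _ "(q, d) # l"]) auto
  qed
  then have "combos Q D \<subseteq> ?F ` lists (Q \<times> D)" by blast
  then show ?thesis using assms by (meson countable_SIGMA countable_image countable_lists countable_subset)
qed

section \<open>Closed subspaces, their functionals, and density by Hahn-Banach\<close>

locale linf_c_subspace =
  fixes X :: "('g, 'k::{real_normed_field, euclidean_space}) fspace" and \<Gamma> :: "'g set"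
  assumes closed_subspace: "closed_subspace X (linf_c \<Gamma>)"
begin

lemma vnorm_X [simp]: "vnorm X = sup_norm"
  using closed_subspace by (simp add: closed_subspace_def linf_c_def)

lemma zero_X [simp]: "(\<lambda>i. 0) \<in> vecs X"
  using closed_subspace by (simp add: closed_subspace_def)

lemma add_X [simp]: "f \<in> vecs X \<Longrightarrow> g \<in> vecs X \<Longrightarrow> (\<lambda>i. f i + g i) \<in> vecs X"
  using closed_subspace by (simp add: closed_subspace_def)

lemma cmult_X [simp]: "f \<in> vecs X \<Longrightarrow> (\<lambda>i. c * f i) \<in> vecs X"
  using closed_subspace by (simp add: closed_subspace_def)

lemma vecs_X_linf_c: "vecs X \<subseteq> vecs (linf_c \<Gamma>)"
  using closed_subspace by (simp add: closed_subspace_def)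

lemma bounded_X [simp]: "f \<in> vecs X \<Longrightarrow> bounded (range f)"
  using vecs_X_linf_c by (auto simp: linf_c_def)

lemma off_X: "f \<in> vecs X \<Longrightarrow> i \<notin> \<Gamma> \<Longrightarrow> f i = 0"
  using vecs_X_linf_c by (auto simp: linf_c_def)

lemma countable_support_X: "f \<in> vecs X \<Longrightarrow> countable {i. f i \<noteq> 0}"
proof -
  assume f: "f \<in> vecs X"
  then have "{i. f i \<noteq> 0} = {i \<in> \<Gamma>. f i \<noteq> 0}" using off_X by auto
  then show ?thesis using f vecs_X_linf_c by (auto simp: linf_c_def)
qed

text \<open>Closedness is relative to \<open>linf_c \<Gamma>\<close>, so the limit must first be
  placed there. Its support lies in the union of the supports of countably many
  approximants.\<close>

lemma uniform_limit_X:
  assumes lim: "\<And>\<epsilon>. \<epsilon> > 0 \<Longrightarrow> \<exists>g\<in>vecs X. \<forall>i. norm (f i - g i) \<le> \<epsilon>"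
  shows "f \<in> vecs X"
proof -
  have "\<exists>g\<in>vecs X. \<forall>i. norm (f i - g i) \<le> inverse (Suc n)" for n
    by (rule lim) simp
  then obtain g where g: "\<And>n. g n \<in> vecs X" "\<And>n i. norm (f i - g n i) \<le> inverse (Suc n)" by metis
  have zero: "f i = 0" if "\<And>n. g n i = 0" for i
  proof (rule ccontr)
    assume "f i \<noteq> 0"
    then obtain n where "inverse (Suc n) < norm (f i)" using reals_Archimedean[of "norm (f i)"] by auto
    then show False using g(2)[of i n] that[of n] by simp
  qed
  have "{i \<in> \<Gamma>. f i \<noteq> 0} \<subseteq> (\<Union>n. {i. g n i \<noteq> 0})" using zero by blast
  then have "countable {i \<in> \<Gamma>. f i \<noteq> 0}"
    using countable_support_X[OF g(1)] by (meson countable_UN countable_subset countableI_type)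
  moreover have "norm (f i) \<le> 1 + sup_norm (g 0)" for i
    using g(2)[of i 0] norm_le_sup_norm[OF bounded_X[OF g(1)[of 0]], of i] norm_triangle_sub[of "f i" "g 0 i"] by simp
  then have "bounded (range f)" by (rule bounded_rangeI)
  moreover have "f i = 0" if "i \<notin> \<Gamma>" for i by (rule zero) (simp add: off_X[OF g(1) that])
  ultimately have f: "f \<in> vecs (linf_c \<Gamma>)" by (simp add: linf_c_def)
  have "closedin (norm_topology (linf_c \<Gamma>)) (vecs X)"
    using closed_subspace by (simp add: closed_subspace_def)
  then have "(\<forall>\<epsilon>>0. \<exists>g\<in>vecs X. sup_norm (\<lambda>i. f i - g i) < \<epsilon>) \<longrightarrow> f \<in> vecs X"
    using f by (subst (asm) closedin_norm_topology_iff) (auto simp: linf_c_def)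
  moreover have "\<exists>g\<in>vecs X. sup_norm (\<lambda>i. f i - g i) < \<epsilon>" if "\<epsilon> > 0" for \<epsilon> :: real
  proof -
    obtain g where g: "g \<in> vecs X" "\<And>i. norm (f i - g i) \<le> \<epsilon> / 2" using lim[of "\<epsilon> / 2"] \<open>\<epsilon> > 0\<close> by auto
    have "sup_norm (\<lambda>i. f i - g i) \<le> \<epsilon> / 2" by (rule sup_norm_le) (rule g)
    then show ?thesis using g(1) \<open>\<epsilon> > 0\<close> by (intro bexI[of _ g]) auto
  qed
  ultimately show ?thesis by blast
qed

lemma diff_X [simp]: "f \<in> vecs X \<Longrightarrow> g \<in> vecs X \<Longrightarrow> (\<lambda>i. f i - g i) \<in> vecs X"
  using add_X[of f "\<lambda>i. - 1 * g i"] cmult_X[of g "- 1"] by simp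

lemma sum_X: "(\<And>k. k \<in> F \<Longrightarrow> f k \<in> vecs X) \<Longrightarrow> (\<lambda>i. \<Sum>k\<in>F. f k i) \<in> vecs X"
  by (induction F rule: infinite_finite_induct) auto

lemma combos_X: "D \<subseteq> vecs X \<Longrightarrow> c \<in> combos Q D \<Longrightarrow> c \<in> vecs X"
  by (rotate_tac, induction rule: combos.induct) auto

lemma separable_X_iff:
  "separable X \<longleftrightarrow> (\<exists>C. countable C \<and> C \<subseteq> vecs X \<and>
    (\<forall>f\<in>vecs X. \<forall>\<epsilon>>0. \<exists>g\<in>C. sup_norm (\<lambda>i. f i - g i) < \<epsilon>))"
  by (rule separable_iff) auto

lemma dual_iff:
  "\<phi> \<in> vecs (dual_space X) \<longleftrightarrow> (\<forall>f. f \<notin> vecs X \<longrightarrow> \<phi> f = 0) \<and>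
     (\<forall>f\<in>vecs X. \<forall>g\<in>vecs X. \<phi> (\<lambda>i. f i + g i) = \<phi> f + \<phi> g) \<and>
     (\<forall>c. \<forall>f\<in>vecs X. \<phi> (\<lambda>i. c * f i) = c * \<phi> f) \<and>
     (\<exists>C. \<forall>f\<in>vecs X. norm (\<phi> f) \<le> C * sup_norm f)"
  by (simp add: dual_space_def)

lemma dual_add: "\<phi> \<in> vecs (dual_space X) \<Longrightarrow> f \<in> vecs X \<Longrightarrow> g \<in> vecs X \<Longrightarrow> \<phi> (\<lambda>i. f i + g i) = \<phi> f + \<phi> g"
  by (simp add: dual_iff)

lemma dual_cmult: "\<phi> \<in> vecs (dual_space X) \<Longrightarrow> f \<in> vecs X \<Longrightarrow> \<phi> (\<lambda>i. c * f i) = c * \<phi> f"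
  by (simp add: dual_iff)

lemma dual_zero: "\<phi> \<in> vecs (dual_space X) \<Longrightarrow> \<phi> (\<lambda>i. 0) = 0"
  using dual_cmult[of \<phi> "\<lambda>i. 0" 0] by simp

lemma dual_sum:
  "\<phi> \<in> vecs (dual_space X) \<Longrightarrow> (\<And>k. k \<in> F \<Longrightarrow> f k \<in> vecs X) \<Longrightarrow> \<phi> (\<lambda>i. \<Sum>k\<in>F. f k i) = (\<Sum>k\<in>F. \<phi> (f k))"
  by (induction F rule: infinite_finite_induct) (auto simp: dual_zero dual_add[OF _ _ sum_X])

definition coord :: "'g \<Rightarrow> ('g \<Rightarrow> 'k) \<Rightarrow> 'k" where
  "coord i f = (if f \<in> vecs X then f i else 0)"

lemma coord_dual: "coord i \<in> vecs (dual_space X)"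
  unfolding dual_iff by (auto simp: coord_def norm_le_sup_norm intro!: exI[of _ 1])

text \<open>The distance \<open>p\<close> to the combinations satisfies the hypotheses of
  \<open>hahn_banach_seminorm\<close>. A functional dominated by \<open>p\<close> vanishes on
  \<open>D\<close>, hence at \<open>y\<close> by assumption; choosing it to attain
  \<open>p y\<close> at \<open>y\<close> gives \<open>p y = 0\<close>.\<close>

theorem mem_closure_combos:
  assumes D: "D \<subseteq> vecs X" and y: "y \<in> vecs X"
    and Q: "\<And>t \<epsilon>. \<epsilon> > 0 \<Longrightarrow> \<exists>q\<in>Q. norm (t - q) < \<epsilon>"
    and ann: "\<And>\<phi>. \<phi> \<in> vecs (dual_space X) \<Longrightarrow> (\<And>d. d \<in> D \<Longrightarrow> \<phi> d = 0) \<Longrightarrow> \<phi> y = 0"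
    and \<epsilon>: "\<epsilon> > 0"
  shows "\<exists>c\<in>combos Q D. sup_norm (\<lambda>i. y i - c i) < \<epsilon>"
proof -
  define C where "C = combos Q D"
  define p where "p x = (INF c\<in>C. sup_norm (\<lambda>i. x i - c i))" for x
  have CX: "c \<in> vecs X" if "c \<in> C" for c using that combos_X[OF D] by (auto simp: C_def)
  have C0: "(\<lambda>i. 0) \<in> C" by (simp add: C_def combos_zero)
  have nn: "0 \<le> sup_norm (\<lambda>i. x i - c i)" if "x \<in> vecs X" "c \<in> C" for x c
    using that CX by (intro sup_norm_nonneg bounded_range_diff) auto
  have le: "p x \<le> sup_norm (\<lambda>i. x i - c i)" if "x \<in> vecs X" "c \<in> C" for x c
    unfolding p_def using that nn by (intro cINF_lower bdd_belowI2[of _ 0]) auto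
  have less: "\<exists>c\<in>C. sup_norm (\<lambda>i. x i - c i) < m" if "x \<in> vecs X" "p x < m" for x m
    using that C0 nn unfolding p_def by (subst (asm) cINF_less_iff) (auto intro!: bdd_belowI2[of _ 0])
  \<comment> \<open>\<open>Q\<close> need not be closed under multiplication, so a scalar multiple
    of a combination is only approximated by another combination. This is what homogeneity of
    \<open>p\<close> rests on.\<close>
  have approx: "\<exists>c'\<in>C. sup_norm (\<lambda>i. t * c i - c' i) < e" if "c \<in> C" "e > 0" for c t e
    using that unfolding C_def
  proof (induction arbitrary: e rule: combos.induct)
    case combos_zero
    then show ?case by (intro bexI[of _ "\<lambda>i. 0"]) (auto simp: sup_norm_def combos.combos_zero)
  next
    case (combos_step q d c)
    have d: "d \<in> vecs X" and c: "c \<in> vecs X" using combos_step D combos_X by auto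
    obtain c' where c': "c' \<in> combos Q D" "sup_norm (\<lambda>i. t * c i - c' i) < e / 2"
      using combos_step.IH[of "e / 2"] combos_step.prems by auto
    have n: "0 \<le> sup_norm d" using d by (simp add: sup_norm_nonneg)
    \<comment> \<open>The added 1 keeps the denominator positive when \<open>d\<close> is
      zero.\<close>
    obtain q' where q': "q' \<in> Q" "norm (t * q - q') < e / 2 / (sup_norm d + 1)"
      using Q[of "e / 2 / (sup_norm d + 1)" "t * q"] combos_step.prems n by auto
    have "norm (t * (q * d i + c i) - (q' * d i + c' i)) \<le> e / 2 + sup_norm (\<lambda>i. t * c i - c' i)" for i
    proof -
      have "norm (t * (q * d i + c i) - (q' * d i + c' i)) = norm ((t * q - q') * d i + (t * c i - c' i))"
        by (simp add: algebra_simps)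
      also have "\<dots> \<le> norm (t * q - q') * norm (d i) + norm (t * c i - c' i)"
        by (metis norm_mult norm_triangle_ineq)
      also have "norm (t * q - q') * norm (d i) \<le> e / 2 / (sup_norm d + 1) * (sup_norm d + 1)"
        using q' d n norm_le_sup_norm[of d i] combos_step.prems by (intro mult_mono) auto
      also have "\<dots> = e / 2" using n by (simp del: divide_divide_eq_left)
      also have "norm (t * c i - c' i) \<le> sup_norm (\<lambda>i. t * c i - c' i)"
        using c c' combos_X[OF D] by (intro norm_le_sup_norm) auto
      finally show ?thesis by simp
    qed
    then have "sup_norm (\<lambda>i. t * (q * d i + c i) - (q' * d i + c' i)) \<le> e / 2 + sup_norm (\<lambda>i. t * c i - c' i)"
      by (rule sup_norm_le)
    then show ?case
      using c' combos.combos_step[OF q'(1) \<open>d \<in> D\<close> c'(1)] by (intro bexI[of _ "\<lambda>i. q' * d i + c' i"]) auto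
  qed
  have p_add: "p (\<lambda>i. x i + z i) \<le> p x + p z" if x: "x \<in> vecs X" and z: "z \<in> vecs X" for x z
  proof (rule field_le_epsilon)
    fix e :: real assume "e > 0"
    then obtain a b where a: "a \<in> C" "sup_norm (\<lambda>i. x i - a i) < p x + e / 2"
      and b: "b \<in> C" "sup_norm (\<lambda>i. z i - b i) < p z + e / 2"
      using less[OF x, of "p x + e / 2"] less[OF z, of "p z + e / 2"] by auto
    have "p (\<lambda>i. x i + z i) \<le> sup_norm (\<lambda>i. (x i + z i) - (a i + b i))"
      using x z a b by (intro le) (auto simp: C_def combos_add)
    also have "\<dots> \<le> sup_norm (\<lambda>i. x i - a i) + sup_norm (\<lambda>i. z i - b i)"
      using sup_norm_add[of "\<lambda>i. x i - a i" "\<lambda>i. z i - b i"] x z a b CX by (simp add: algebra_simps)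
    finally show "p (\<lambda>i. x i + z i) \<le> p x + p z + e" using a b by simp
  qed
  have p_cmult: "p (\<lambda>i. t * x i) \<le> norm t * p x" if x: "x \<in> vecs X" for t x
  proof (rule field_le_epsilon)
    fix e :: real assume e: "e > 0"
    then have "p x < p x + e / 2 / (norm t + 1)" by (simp add: add_nonneg_pos)
    then obtain a where a: "a \<in> C" "sup_norm (\<lambda>i. x i - a i) < p x + e / 2 / (norm t + 1)"
      using less[OF x] by blast
    obtain b where b: "b \<in> C" "sup_norm (\<lambda>i. t * a i - b i) < e / 2"
      using approx[OF a(1), of "e / 2" t] e by auto
    have "p (\<lambda>i. t * x i) \<le> sup_norm (\<lambda>i. t * x i - b i)" using x b by (intro le) auto
    also have "\<dots> \<le> sup_norm (\<lambda>i. t * x i - t * a i) + sup_norm (\<lambda>i. t * a i - b i)"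
      using x a b CX by (intro sup_norm_triangle) auto
    also have "sup_norm (\<lambda>i. t * x i - t * a i) = norm t * sup_norm (\<lambda>i. x i - a i)"
      using sup_norm_cmult[of "\<lambda>i. x i - a i" t] x a CX by (simp add: algebra_simps)
    also have "\<dots> \<le> norm t * (p x + e / 2 / (norm t + 1))"
      using a by (intro mult_left_mono) auto
    also have "\<dots> \<le> norm t * p x + e / 2"
    proof -
      have "norm t / (norm t + 1) \<le> 1" by (simp add: divide_le_eq_1 add_nonneg_pos)
      then have "e / 2 * (norm t / (norm t + 1)) \<le> e / 2 * 1" using e by (intro mult_left_mono) auto
      then show ?thesis by (simp add: algebra_simps)
    qed
    finally show "p (\<lambda>i. t * x i) \<le> norm t * p x + e" using b by simp
  qed
  have vs: "vector_space (\<lambda>(c::'k) (f::'g \<Rightarrow> 'k) i. c * f i)"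
    by unfold_locales (auto simp: fun_eq_iff algebra_simps)
  then have ms: "module (\<lambda>(c::'k) (f::'g \<Rightarrow> 'k) i. c * f i)" by (simp add: module_iff_vector_space)
  have sub: "module.subspace (\<lambda>(c::'k) (f::'g \<Rightarrow> 'k) i. c * f i) (vecs X)"
    unfolding module.subspace_def[OF ms] by (auto simp: plus_fun_def zero_fun_def)
  obtain \<psi> where \<psi>: "\<And>x z. x \<in> vecs X \<Longrightarrow> z \<in> vecs X \<Longrightarrow> \<psi> (\<lambda>i. x i + z i) = \<psi> x + \<psi> z"
    "\<And>c x. x \<in> vecs X \<Longrightarrow> \<psi> (\<lambda>i. c * x i) = c * \<psi> x" "\<And>x. x \<in> vecs X \<Longrightarrow> norm (\<psi> x) \<le> p x"
    "\<psi> y \<bullet> 1 = p y"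
    by (rule hahn_banach_seminorm[OF vs sub y, of p, unfolded plus_fun_def])
      (assumption | rule p_add p_cmult | (rule that; simp))+
  define \<phi> where "\<phi> x = (if x \<in> vecs X then \<psi> x else 0)" for x
  have "norm (\<psi> x) \<le> 1 * sup_norm x" if "x \<in> vecs X" for x
    using \<psi>(3)[OF that] le[OF that C0] by simp
  then have "\<phi> \<in> vecs (dual_space X)"
    unfolding dual_iff by (auto simp: \<phi>_def \<psi> intro!: exI[of _ 1])
  moreover have "\<phi> d = 0" if "d \<in> D" for d
  proof -
    have d: "d \<in> vecs X" using that D by auto
    \<comment> \<open>The scalar 1 need not belong to \<open>Q\<close>, so \<open>d\<close> is
      approximated by multiples \<open>q * d\<close> with \<open>q\<close> close to 1.\<close>
    have "p d \<le> 0"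
    proof (rule field_le_epsilon)
      fix e :: real assume e: "e > 0"
      obtain q where q: "q \<in> Q" "norm (1 - q) < e / (sup_norm d + 1)"
        using Q[of "e / (sup_norm d + 1)" 1] e sup_norm_nonneg[of d] d by auto
      have n: "0 \<le> sup_norm d" using d by (simp add: sup_norm_nonneg)
      have "p d \<le> sup_norm (\<lambda>i. d i - (q * d i + 0))"
        by (rule le[OF d]) (use combos_step[OF q(1) that combos_zero] in \<open>simp add: C_def\<close>)
      also have "\<dots> = norm (1 - q) * sup_norm d"
        using sup_norm_cmult[of d "1 - q"] d by (simp add: algebra_simps)
      also have "\<dots> \<le> e / (sup_norm d + 1) * (sup_norm d + 1)"
        using q n e by (intro mult_mono) auto
      finally show "p d \<le> 0 + e" using n by simp
    qed
    then have "norm (\<psi> d) \<le> 0" using \<psi>(3)[OF d] by linarith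
    then show ?thesis using d by (simp add: \<phi>_def)
  qed
  ultimately have "\<phi> y = 0" by (rule ann)
  then have "p y = 0" using \<psi>(4) y by (simp add: \<phi>_def)
  then show ?thesis using less[OF y, of \<epsilon>] \<epsilon> by (simp add: C_def)
qed

text \<open>Combinations with coefficients from a countable dense set of scalars form a countable
  dense set. Separability is thereby reduced to finding countably many vectors that no nonzero
  functional annihilates.\<close>

corollary separable_if_total:
  assumes "countable D" "D \<subseteq> vecs X"
    and ann: "\<And>\<phi> y. \<phi> \<in> vecs (dual_space X) \<Longrightarrow> (\<And>d. d \<in> D \<Longrightarrow> \<phi> d = 0) \<Longrightarrow> y \<in> vecs X \<Longrightarrow> \<phi> y = 0"
  shows "separable X"
proof -
  obtain Q :: "'k set" where Q: "countable Q" "\<And>U. open U \<Longrightarrow> U \<noteq> {} \<Longrightarrow> \<exists>q\<in>Q. q \<in> U"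
    using countable_dense_exists by blast
  have "\<exists>q\<in>Q. norm (t - q) < \<epsilon>" if "\<epsilon> > 0" for t \<epsilon>
    using Q(2)[of "ball t \<epsilon>"] that by (auto simp: dist_norm)
  then have "\<forall>f\<in>vecs X. \<forall>\<epsilon>>0. \<exists>g\<in>combos Q D. sup_norm (\<lambda>i. f i - g i) < \<epsilon>"
    using mem_closure_combos[OF assms(2)] ann by blast
  then show ?thesis
    unfolding separable_X_iff using countable_combos[OF Q(1) assms(1)] combos_X[OF assms(2)] by blast
qed

end

section \<open>The spaces \<open>c\<^sub>0(I)\<close> and bounded injections\<close>

context includes cardinal_syntax
begin

lemma uncountable_omega1: "uncountable omega1"
proof -
  have co: "Card_order natLeq" by (rule natLeq_Card_order)
  have "natLeq <o cardSuc natLeq" by (rule cardSuc_greater[OF co])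
  moreover have "|omega1| =o cardSuc natLeq"
    unfolding omega1_def by (rule card_of_Field_ordIso[OF cardSuc_Card_order[OF co]])
  ultimately have "natLeq <o |omega1|" using ordLess_ordIso_trans ordIso_symmetric by blast
  then show ?thesis by (simp add: countable_card_le_natLeq not_ordLeq_ordLess not_ordLess_ordLeq)
qed

text \<open>The cardinal successor of the countable cardinal is the least cardinal above it, hence
  at most the cardinality of any uncountable set.\<close>

lemma omega1_inj_into_uncountable:
  assumes "uncountable F"
  obtains h where "inj_on h omega1" "h ` omega1 \<subseteq> F"
proof -
  have co: "Card_order natLeq" by (rule natLeq_Card_order)
  have "natLeq <o |F|"
    using assms unfolding countable_card_le_natLeq
    by (simp add: card_of_Well_order natLeq_Well_order not_ordLeq_iff_ordLess)
  then have "cardSuc natLeq \<le>o |F|"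
    using cardSuc_least[OF co card_of_Card_order] by blast
  moreover have "|omega1| =o cardSuc natLeq"
    unfolding omega1_def by (rule card_of_Field_ordIso[OF cardSuc_Card_order[OF co]])
  ultimately have "|omega1| \<le>o |F|" using ordIso_ordLeq_trans by blast
  then show thesis using that by (auto simp: card_of_ordLeq[symmetric])
qed

end

section \<open>Consequences of boundedness and linearity of an operator\<close>

lemma bounded_operator_mem: "bounded_operator X Y T \<Longrightarrow> f \<in> vecs X \<Longrightarrow> T f \<in> vecs Y"
  by (auto simp: bounded_operator_def)

lemma bounded_operator_add:
  "bounded_operator X Y T \<Longrightarrow> f \<in> vecs X \<Longrightarrow> g \<in> vecs X \<Longrightarrow> T (\<lambda>i. f i + g i) = (\<lambda>j. T f j + T g j)"
  by (simp add: bounded_operator_def)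

lemma bounded_operator_cmult:
  "bounded_operator X Y T \<Longrightarrow> f \<in> vecs X \<Longrightarrow> T (\<lambda>i. c * f i) = (\<lambda>j. c * T f j)"
  by (simp add: bounded_operator_def)

lemma bounded_operator_bound:
  assumes "bounded_operator X Y T"
  obtains C where "\<And>f. f \<in> vecs X \<Longrightarrow> vnorm Y (T f) \<le> C * vnorm X f"
  using assms unfolding bounded_operator_def by blast

section \<open>Vector operations and bounded functionals on \<open>c0 I\<close>\<close>

lemma vnorm_c0 [simp]: "vnorm (c0 I) = sup_norm"
  by (simp add: c0_def)

lemma c0_off: "a \<in> vecs (c0 I) \<Longrightarrow> \<alpha> \<notin> I \<Longrightarrow> a \<alpha> = 0"
  by (simp add: c0_def)

lemma c0_finite: "a \<in> vecs (c0 I) \<Longrightarrow> \<epsilon> > 0 \<Longrightarrow> finite {\<alpha> \<in> I. norm (a \<alpha>) \<ge> \<epsilon>}"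
  by (simp add: c0_def)

lemma c0_bounded: 
  assumes "a \<in> vecs (c0 I)"
  shows "bounded (range a)"
proof -
  have "range a \<subseteq> a ` {\<alpha> \<in> I. norm (a \<alpha>) \<ge> 1} \<union> cball 0 1"
    using c0_off[OF assms] by (auto simp: image_iff) (metis linear norm_zero zero_le_one)
  then show ?thesis
    using c0_finite[OF assms, of 1] by (meson bounded_Un bounded_cball bounded_subset finite_imageI finite_imp_bounded zero_less_one)
qed

lemma c0_finite_support: "finite F \<Longrightarrow> F \<subseteq> I \<Longrightarrow> (\<And>\<alpha>. \<alpha> \<notin> F \<Longrightarrow> a \<alpha> = 0) \<Longrightarrow> a \<in> vecs (c0 I)"
  unfolding c0_def by (auto intro!: finite_subset[of _ F]) (metis norm_zero not_less)

lemma c0_add: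
  assumes "a \<in> vecs (c0 I)" "b \<in> vecs (c0 I)"
  shows "(\<lambda>\<alpha>. a \<alpha> + b \<alpha>) \<in> vecs (c0 I)"
proof -
  have "finite {\<alpha> \<in> I. \<epsilon> \<le> norm (a \<alpha> + b \<alpha>)}" if "\<epsilon> > 0" for \<epsilon>
  proof (rule finite_subset)
    show "{\<alpha> \<in> I. \<epsilon> \<le> norm (a \<alpha> + b \<alpha>)} \<subseteq>
      {\<alpha> \<in> I. \<epsilon> / 2 \<le> norm (a \<alpha>)} \<union> {\<alpha> \<in> I. \<epsilon> / 2 \<le> norm (b \<alpha>)}"
    proof
      fix \<alpha> assume "\<alpha> \<in> {\<alpha> \<in> I. \<epsilon> \<le> norm (a \<alpha> + b \<alpha>)}"
      then show "\<alpha> \<in> {\<alpha> \<in> I. \<epsilon> / 2 \<le> norm (a \<alpha>)} \<union> {\<alpha> \<in> I. \<epsilon> / 2 \<le> norm (b \<alpha>)}"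
        using norm_triangle_ineq[of "a \<alpha>" "b \<alpha>"] by auto
    qed
    show "finite ({\<alpha> \<in> I. \<epsilon> / 2 \<le> norm (a \<alpha>)} \<union> {\<alpha> \<in> I. \<epsilon> / 2 \<le> norm (b \<alpha>)})"
      using assms that by (intro finite_UnI c0_finite) auto
  qed
  then show ?thesis using assms by (simp add: c0_def)
qed

lemma c0_cmult:
  assumes "a \<in> vecs (c0 I)"
  shows "(\<lambda>\<alpha>. c * a \<alpha>) \<in> vecs (c0 I)"
proof (cases "c = 0")
  case True
  then show ?thesis by (intro c0_finite_support[of "{}"]) auto
next
  case False
  have "finite {\<alpha> \<in> I. \<epsilon> \<le> norm (c * a \<alpha>)}" if "\<epsilon> > 0" for \<epsilon>
    using c0_finite[OF assms, of "\<epsilon> / norm c"] that False by (simp add: norm_mult field_simps)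
  then show ?thesis using assms by (simp add: c0_def)
qed

lemma c0_diff:
  assumes "a \<in> vecs (c0 I)" "b \<in> vecs (c0 I)"
  shows "(\<lambda>\<alpha>. a \<alpha> - b \<alpha>) \<in> vecs (c0 I)"
  using c0_add[OF assms(1) c0_cmult[OF assms(2), of "- 1"]] by simp

definition unit_vec :: "'i \<Rightarrow> 'i \<Rightarrow> 'k::{real_normed_field, euclidean_space}" where
  "unit_vec \<alpha> \<beta> = (if \<beta> = \<alpha> then 1 else 0)"

lemma unit_vec_c0: "\<alpha> \<in> I \<Longrightarrow> unit_vec \<alpha> \<in> vecs (c0 I)"
  by (rule c0_finite_support[of "{\<alpha>}"]) (auto simp: unit_vec_def)

text \<open>This is the inclusion of the dual of \<open>c0 I\<close> in the absolutely summable
  families. Testing \<open>\<phi>\<close> on finite sums of unit vectors with coefficients of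
  modulus at most 1 bounds all finite sums of \<open>norm (\<phi> (unit_vec \<alpha>))\<close>, and
  a summable family has countable support.\<close>

lemma countable_c0_functional_support:
  fixes \<phi> :: "('i \<Rightarrow> 'k::{real_normed_field, euclidean_space}) \<Rightarrow> 'k"
  assumes add: "\<And>f g. f \<in> vecs (c0 I) \<Longrightarrow> g \<in> vecs (c0 I) \<Longrightarrow> \<phi> (\<lambda>i. f i + g i) = \<phi> f + \<phi> g"
    and cmult: "\<And>c f. f \<in> vecs (c0 I) \<Longrightarrow> \<phi> (\<lambda>i. c * f i) = c * \<phi> f"
    and bound: "\<And>f. f \<in> vecs (c0 I) \<Longrightarrow> norm (\<phi> f) \<le> C * sup_norm f"
  shows "countable {\<alpha> \<in> I. \<phi> (unit_vec \<alpha>) \<noteq> 0}"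
proof -
  define h where "h \<alpha> = norm (\<phi> (unit_vec \<alpha>))" for \<alpha>
  have "sum h F \<le> \<bar>C\<bar>" if F: "finite F" "F \<subseteq> I" for F
  proof -
    \<comment> \<open>This scalar rotates \<open>\<phi> (unit_vec \<alpha>)\<close> onto its norm.
      If that value is zero, division gives \<open>s \<alpha> = 0\<close>, so the coefficients have
      norm at most 1 in every case.\<close>
    define s where "s \<alpha> = of_real (h \<alpha>) / \<phi> (unit_vec \<alpha>)" for \<alpha>
    define f where "f G = (\<lambda>i. \<Sum>\<alpha>\<in>G. s \<alpha> * unit_vec \<alpha> i)" for G
    have f_eq: "f G i = (if i \<in> G then s i else 0)" if "finite G" for G i
      using that by (simp add: f_def unit_vec_def if_distrib[where f = "\<lambda>x. _ * x"] sum.delta' cong: if_cong)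
    have fc: "f G \<in> vecs (c0 I)" if "G \<subseteq> F" for G
      using that F finite_subset[OF that F(1)] by (intro c0_finite_support[of G]) (auto simp: f_eq)
    have ph: "\<phi> (f G) = of_real (sum h G)" if "finite G" "G \<subseteq> F" for G
      using that
    proof (induction G)
      case empty
      show ?case using cmult[OF fc[of "{}"], of 0] by (simp add: f_def)
    next
      case (insert \<alpha> G)
      have "f (insert \<alpha> G) = (\<lambda>i. s \<alpha> * unit_vec \<alpha> i + f G i)"
        using insert by (simp add: f_def)
      then have "\<phi> (f (insert \<alpha> G)) = s \<alpha> * \<phi> (unit_vec \<alpha>) + \<phi> (f G)"
        using insert F fc[of G] unit_vec_c0[of \<alpha> I] add[OF c0_cmult[of "unit_vec \<alpha>" I "s \<alpha>"], of "f G"]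
        by (auto simp: cmult)
      also have "s \<alpha> * \<phi> (unit_vec \<alpha>) = of_real (h \<alpha>)"
        by (simp add: s_def h_def)
      finally show ?case using insert by simp
    qed
    have "norm (f F i) \<le> 1" for i
      using F(1) by (simp add: f_eq s_def h_def norm_divide)
    then have n: "sup_norm (f F) \<le> 1" by (rule sup_norm_le)
    have "0 \<le> sum h F" by (simp add: h_def sum_nonneg)
    then have "sum h F = norm (\<phi> (f F))" using ph[of F] F by (simp del: of_real_sum)
    also have "\<dots> \<le> C * sup_norm (f F)" by (rule bound) (simp add: fc)
    also have "\<dots> \<le> \<bar>C\<bar> * 1"
      using n sup_norm_nonneg[OF c0_bounded[OF fc[of F]]] by (intro mult_mono) auto
    finally show ?thesis by simp
  qed
  then have "h summable_on I"
    by (intro nonneg_bdd_above_summable_on bdd_aboveI2[of _ _ "\<bar>C\<bar>"]) (auto simp: h_def)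
  then have "countable {\<alpha> \<in> I. h \<alpha> \<noteq> 0}" by (rule summable_countable_real)
  then show ?thesis by (simp add: h_def)
qed

text \<open>Each of the countably many coordinates of \<open>T\<close> is nonzero at only countably
  many unit vectors, so some unit vector indexed by \<open>I\<close> lies in the kernel.\<close>

lemma not_injects_c0_linf:
  assumes "uncountable I"
  shows "\<not> injects (c0 I :: ('i, 'k::{real_normed_field, euclidean_space}) fspace) linf"
proof
  assume "injects (c0 I :: ('i, 'k) fspace) linf"
  then obtain T where T: "bounded_operator (c0 I) (linf :: (nat, 'k) fspace) T"
    and inj: "inj_on T (vecs (c0 I))"
    unfolding injects_def by blast
  from bounded_operator_bound[OF T] obtain C
    where C: "\<And>f. f \<in> vecs (c0 I) \<Longrightarrow> sup_norm (T f) \<le> C * sup_norm f"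
    unfolding linf_def c0_def by auto
  have "countable {\<alpha> \<in> I. T (unit_vec \<alpha>) n \<noteq> 0}" for n
  proof (rule countable_c0_functional_support[of I "\<lambda>f. T f n" C])
    fix f :: "'i \<Rightarrow> 'k" assume f: "f \<in> vecs (c0 I)"
    have "norm (T f n) \<le> sup_norm (T f)"
      using bounded_operator_mem[OF T f] by (intro norm_le_sup_norm) (simp add: linf_def)
    then show "norm (T f n) \<le> C * sup_norm f" using C[OF f] by linarith
  qed (simp_all add: bounded_operator_add[OF T] bounded_operator_cmult[OF T])
  then have "countable (\<Union>n. {\<alpha> \<in> I. T (unit_vec \<alpha>) n \<noteq> 0})" by blast
  then have "\<not> I \<subseteq> (\<Union>n. {\<alpha> \<in> I. T (unit_vec \<alpha>) n \<noteq> 0})"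
    using assms countable_subset by blast
  then obtain \<alpha> where \<alpha>: "\<alpha> \<in> I" "\<And>n. T (unit_vec \<alpha>) n = 0" by auto
  have "T (\<lambda>i. 0 * unit_vec \<alpha> i) = (\<lambda>j. 0 * T (unit_vec \<alpha>) j)"
    by (rule bounded_operator_cmult[OF T]) (rule unit_vec_c0[OF \<alpha>(1)])
  also have "\<dots> = T (unit_vec \<alpha>)" using \<alpha>(2) by (simp add: fun_eq_iff)
  finally have "(\<lambda>i. 0 * unit_vec \<alpha> i) = (unit_vec \<alpha> :: 'i \<Rightarrow> 'k)"
    by (rule inj_onD[OF inj]) (intro c0_cmult unit_vec_c0 \<alpha>(1))+
  then have "0 * unit_vec \<alpha> \<alpha> = (unit_vec \<alpha> \<alpha> :: 'k)" by (rule fun_cong)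
  then show False by (simp add: unit_vec_def)
qed

lemma isometrically_isomorphic_imp_isomorphic:
  assumes iso: "isometrically_isomorphic X Y"
    and add: "\<And>f g. f \<in> vecs X \<Longrightarrow> g \<in> vecs X \<Longrightarrow> (\<lambda>i. f i + g i) \<in> vecs X"
    and cmult: "\<And>c f. f \<in> vecs X \<Longrightarrow> (\<lambda>i. c * f i) \<in> vecs X"
  shows "isomorphic X Y"
proof -
  obtain T where T: "bounded_operator X Y T" "bij_betw T (vecs X) (vecs Y)"
    "\<And>f. f \<in> vecs X \<Longrightarrow> vnorm Y (T f) = vnorm X f"
    using iso by (auto simp: isometrically_isomorphic_def)
  let ?S = "inv_into (vecs X) T"
  have S: "?S f \<in> vecs X" "T (?S f) = f" if "f \<in> vecs Y" for f
    using T(2) that by (auto simp: bij_betw_def inv_into_into f_inv_into_f)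
  have ST: "?S (T f) = f" if "f \<in> vecs X" for f
    using T(2) that by (simp add: bij_betw_def)
  have "?S (\<lambda>i. f i + g i) = (\<lambda>j. ?S f j + ?S g j)" if "f \<in> vecs Y" "g \<in> vecs Y" for f g
    using ST[OF add[OF S(1) S(1)], of f g] that S by (simp add: bounded_operator_add[OF T(1)])
  moreover have "?S (\<lambda>i. c * f i) = (\<lambda>j. c * ?S f j)" if "f \<in> vecs Y" for c f
    using ST[OF cmult[OF S(1)], of f c] that S by (simp add: bounded_operator_cmult[OF T(1)])
  moreover have "vnorm X (?S f) \<le> 1 * vnorm Y f" if "f \<in> vecs Y" for f
    using T(3)[OF S(1)[OF that]] S(2)[OF that] by simp
  ultimately have "bounded_operator Y X ?S"
    unfolding bounded_operator_def using S(1) by (intro conjI exI[of _ 1]) auto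
  then show ?thesis unfolding isomorphic_def using T by blast
qed

lemma injects_comp:
  assumes S: "bounded_operator X Y S" "inj_on S (vecs X)" and T: "bounded_operator Y Z T" "inj_on T (vecs Y)"
    and nonneg: "\<And>f. f \<in> vecs Y \<Longrightarrow> 0 \<le> vnorm Y f"
  shows "injects X Z"
proof -
  obtain B where B: "\<And>f. f \<in> vecs X \<Longrightarrow> vnorm Y (S f) \<le> B * vnorm X f"
    using bounded_operator_bound[OF S(1)] by blast
  obtain C where C: "\<And>f. f \<in> vecs Y \<Longrightarrow> vnorm Z (T f) \<le> C * vnorm Y f"
    using bounded_operator_bound[OF T(1)] by blast
  have SY: "S f \<in> vecs Y" if "f \<in> vecs X" for f
    using bounded_operator_mem[OF S(1) that] .
  \<comment> \<open>The constant \<open>C\<close> may be negative; passing to its absolute value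
    uses that the norm on \<open>Y\<close> is nonnegative.\<close>
  have "vnorm Z (T (S f)) \<le> (\<bar>C\<bar> * B) * vnorm X f" if "f \<in> vecs X" for f
  proof -
    have "vnorm Z (T (S f)) \<le> C * vnorm Y (S f)" using C SY that by blast
    also have "\<dots> \<le> \<bar>C\<bar> * vnorm Y (S f)" using nonneg[OF SY[OF that]] by (intro mult_right_mono) auto
    also have "\<dots> \<le> \<bar>C\<bar> * (B * vnorm X f)" using B[OF that] by (intro mult_left_mono) auto
    finally show ?thesis by (simp add: mult.assoc)
  qed
  then have "bounded_operator X Z (\<lambda>f. T (S f))"
    unfolding bounded_operator_def
    by (intro conjI exI[of _ "\<bar>C\<bar> * B"])
      (auto simp: bounded_operator_add[OF S(1)] bounded_operator_add[OF T(1)] bounded_operator_cmult[OF S(1)]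
        bounded_operator_cmult[OF T(1)] bounded_operator_mem[OF T(1)] SY)
  moreover have "inj_on (\<lambda>f. T (S f)) (vecs X)"
    using S(2) T(2) SY by (auto simp: inj_on_def)
  ultimately show ?thesis unfolding injects_def by blast
qed

section \<open>Operators from \<open>X\<close> into the bounded sequences, and copies of
  \<open>c0 I\<close> inside \<open>X\<close>\<close>

context linf_c_subspace
begin

text \<open>The supports of a countable dense set cover a countable set off which every vector of
  \<open>X\<close> vanishes. Listing the coordinates on that set gives an embedding which is even
  isometric.\<close>

lemma separable_imp_embeds_linf:
  assumes "separable X"
  shows "embeds X linf"
proof -
  obtain C where C: "countable C" "C \<subseteq> vecs X"
    "\<And>f \<epsilon>. f \<in> vecs X \<Longrightarrow> \<epsilon> > 0 \<Longrightarrow> \<exists>g\<in>C. sup_norm (\<lambda>i. f i - g i) < \<epsilon>"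
    using assms unfolding separable_X_iff by blast
  define A where "A = (\<Union>g\<in>C. {i. g i \<noteq> 0})"
  have cA: "countable A"
    unfolding A_def using C(1,2) countable_support_X by (intro countable_UN) auto
  have off: "f i = 0" if f: "f \<in> vecs X" and i: "i \<notin> A" for f i
  proof (rule ccontr)
    assume "f i \<noteq> 0"
    then obtain g where g: "g \<in> C" "sup_norm (\<lambda>i. f i - g i) < norm (f i)"
      using C(3)[OF f, of "norm (f i)"] by auto
    have "norm (f i - g i) \<le> sup_norm (\<lambda>i. f i - g i)"
      using f g C(2) by (intro norm_le_sup_norm bounded_range_diff) auto
    moreover have "g i = 0" using g i by (auto simp: A_def)
    ultimately show False using g by simp
  qed
  \<comment> \<open>The enumeration repeats points when \<open>A\<close> is finite and takes a
    default value when \<open>A\<close> is empty. Neither affects the supremum, since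
    \<open>f\<close> vanishes off \<open>A\<close>.\<close>
  define T where "T f = (\<lambda>n. f (from_nat_into A n))" for f :: "'g \<Rightarrow> 'k"
  have bT: "bounded (range (T f))" if "f \<in> vecs X" for f
    using norm_le_sup_norm[OF bounded_X[OF that]] unfolding T_def by (rule bounded_rangeI)
  have "norm (f i) \<le> sup_norm (T f)" if f: "f \<in> vecs X" for f i
  proof (cases "i \<in> A")
    case True
    then obtain n where "from_nat_into A n = i" using from_nat_into_surj[OF cA] by blast
    then show ?thesis using norm_le_sup_norm[OF bT[OF f], of n] by (simp add: T_def)
  next
    case False
    then show ?thesis using off[OF f] sup_norm_nonneg[OF bT[OF f]] by simp
  qed
  then have ge: "sup_norm f \<le> sup_norm (T f)" if "f \<in> vecs X" for f
    using that by (intro sup_norm_le)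
  have le: "sup_norm (T f) \<le> 1 * sup_norm f" if "f \<in> vecs X" for f
    using norm_le_sup_norm[OF bounded_X[OF that]] by (intro sup_norm_le) (simp add: T_def)
  have "bounded_operator X linf T"
    unfolding bounded_operator_def
  proof (intro conjI)
    show "T ` vecs X \<subseteq> vecs linf" using bT by (auto simp: linf_def)
    show "\<exists>C. \<forall>f\<in>vecs X. vnorm linf (T f) \<le> C * vnorm X f"
      using le by (intro exI[of _ 1]) (simp add: linf_def)
  qed (simp_all add: T_def)
  moreover have "\<forall>f\<in>vecs X. 1 * vnorm X f \<le> vnorm linf (T f)" using ge by (simp add: linf_def)
  ultimately show ?thesis unfolding embeds_def by (metis zero_less_one)
qed

lemma embeds_linf_imp_injects_linf:
  assumes "embeds X linf"
  shows "injects X (linf :: (nat, 'k) fspace)"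
proof -
  obtain T c where T: "bounded_operator X (linf :: (nat, 'k) fspace) T"
    and c: "c > 0" "\<And>f. f \<in> vecs X \<Longrightarrow> c * sup_norm f \<le> sup_norm (T f)"
    using assms unfolding embeds_def by (auto simp: linf_def)
  have "inj_on T (vecs X)"
  proof (rule inj_onI)
    fix f g assume fg: "f \<in> vecs X" "g \<in> vecs X" "T f = T g"
    have "T (\<lambda>i. f i + (- 1) * g i) = (\<lambda>j. T f j + T (\<lambda>i. (- 1) * g i) j)"
      by (rule bounded_operator_add[OF T fg(1) cmult_X[OF fg(2)]])
    also have "T (\<lambda>i. (- 1) * g i) = (\<lambda>j. (- 1) * T g j)"
      by (rule bounded_operator_cmult[OF T fg(2)])
    finally have "T (\<lambda>i. f i - g i) = (\<lambda>j. 0)" using fg(3) by simp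
    then have "c * sup_norm (\<lambda>i. f i - g i) \<le> 0"
      using c(2)[OF diff_X[OF fg(1,2)]] by (simp add: sup_norm_def)
    moreover have "0 \<le> sup_norm (\<lambda>i. f i - g i)" using fg by (intro sup_norm_nonneg) auto
    ultimately have "sup_norm (\<lambda>i. f i - g i) = 0"
      using c(1) by (simp add: mult_le_0_iff)
    then show "f = g" using fg sup_norm_eq_0[of "\<lambda>i. f i - g i"] by (auto simp: fun_eq_iff)
  qed
  then show ?thesis using T unfolding injects_def by blast
qed

text \<open>The inverse of the isomorphism followed by the injection of \<open>X\<close> would be a
  bounded injection of \<open>c0 I\<close> into the bounded sequences.\<close>

lemma countable_if_injects_linf_and_contains_c0:
  fixes I :: "'b set"
  assumes inj: "injects X (linf :: (nat, 'k) fspace)" and Y: "closed_subspace Y X" "isomorphic Y (c0 I)"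
  shows "countable I"
proof (rule ccontr)
  assume I: "uncountable I"
  obtain U where U: "bounded_operator X (linf :: (nat, 'k) fspace) U" "inj_on U (vecs X)"
    using inj by (auto simp: injects_def)
  obtain T where T: "bij_betw T (vecs Y) (vecs (c0 I))" "bounded_operator (c0 I) Y (inv_into (vecs Y) T)"
    using Y(2) by (auto simp: isomorphic_def)
  have YX: "vecs Y \<subseteq> vecs X" "vnorm Y = sup_norm" using Y(1) by (auto simp: closed_subspace_def)
  obtain C where C: "\<And>f. f \<in> vecs X \<Longrightarrow> vnorm linf (U f) \<le> C * sup_norm f"
    using bounded_operator_bound[OF U(1)] by auto
  have inj: "inj_on (inv_into (vecs Y) T) (vecs (c0 I))"
    using T(1) by (simp add: bij_betw_def inj_on_inv_into)
  have "bounded_operator Y linf U"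
    unfolding bounded_operator_def
    by (intro conjI exI[of _ C])
      (use YX C in \<open>auto simp: bounded_operator_add[OF U(1)] bounded_operator_cmult[OF U(1)]
        bounded_operator_mem[OF U(1)] subset_iff\<close>)
  moreover have "inj_on U (vecs Y)"
    using U(2) YX(1) by (rule inj_on_subset)
  ultimately have "injects (c0 I :: ('b, 'k) fspace) linf"
    by (rule injects_comp[OF T(2) inj]) (use YX in \<open>auto intro!: sup_norm_nonneg bounded_X\<close>)
  then show False using not_injects_c0_linf[OF I] by blast
qed

text \<open>At each point at most one \<open>f \<alpha>\<close> is nonzero, so the sum of all
  \<open>a \<alpha> * f \<alpha>\<close> makes sense pointwise without convergence, and its supremum
  norm is that of \<open>a\<close>. Its range is closed because the coefficients of a limit can be
  recovered by evaluation.\<close>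

lemma isometric_c0_of_disjoint_family:
  assumes f: "\<And>\<alpha>. \<alpha> \<in> I \<Longrightarrow> f \<alpha> \<in> vecs X" "\<And>\<alpha>. \<alpha> \<in> I \<Longrightarrow> sup_norm (f \<alpha>) = 1"
    and disj: "\<And>\<alpha> \<beta> i. \<alpha> \<in> I \<Longrightarrow> \<beta> \<in> I \<Longrightarrow> f \<alpha> i \<noteq> 0 \<Longrightarrow> f \<beta> i \<noteq> 0 \<Longrightarrow> \<alpha> = \<beta>"
  shows "\<exists>Y. closed_subspace Y X \<and> isometrically_isomorphic Y (c0 I)"
proof -
  \<comment> \<open>\<open>\<iota> i\<close> is the unique index whose function is nonzero at
    \<open>i\<close>. If there is none the choice is arbitrary, but \<open>S a i\<close> is still 0
    for \<open>a\<close> in \<open>c0 I\<close>: either \<open>f (\<iota> i) i = 0\<close> or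
    \<open>\<iota> i\<close> lies outside \<open>I\<close> and \<open>a\<close> vanishes
    there.\<close>
  define \<iota> where "\<iota> i = (SOME \<alpha>. \<alpha> \<in> I \<and> f \<alpha> i \<noteq> 0)" for i
  define S where "S a i = a (\<iota> i) * f (\<iota> i) i" for a i
  have S_on: "S a i = a \<alpha> * f \<alpha> i" if "\<alpha> \<in> I" "f \<alpha> i \<noteq> 0" for a \<alpha> i
  proof -
    have "\<iota> i \<in> I \<and> f (\<iota> i) i \<noteq> 0" unfolding \<iota>_def using that by (intro someI) auto
    then have "\<iota> i = \<alpha>" using disj that by blast
    then show ?thesis by (simp add: S_def)
  qed
  have S_off: "S a i = 0" if "a \<in> vecs (c0 I)" "\<And>\<alpha>. \<alpha> \<in> I \<Longrightarrow> f \<alpha> i = 0" for a i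
    using that c0_off[OF that(1)] by (cases "\<iota> i \<in> I") (auto simp: S_def)
  have f1: "norm (f \<alpha> i) \<le> 1" if "\<alpha> \<in> I" for \<alpha> i
    using norm_le_sup_norm[OF bounded_X[OF f(1)[OF that]], of i] f(2)[OF that] by simp
  have S_add: "S (\<lambda>\<alpha>. a \<alpha> + b \<alpha>) = (\<lambda>i. S a i + S b i)" for a b
    by (rule ext) (simp add: S_def distrib_right)
  have S_diff: "S (\<lambda>\<alpha>. a \<alpha> - b \<alpha>) = (\<lambda>i. S a i - S b i)" for a b
    by (rule ext) (simp add: S_def left_diff_distrib)
  have S_cmult: "S (\<lambda>\<alpha>. c * a \<alpha>) = (\<lambda>i. c * S a i)" for a c
    by (rule ext) (simp add: S_def)
  have SX: "S a \<in> vecs X" if a: "a \<in> vecs (c0 I)" for a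
  proof (rule uniform_limit_X)
    fix \<epsilon> :: real assume \<epsilon>: "\<epsilon> > 0"
    \<comment> \<open>The coefficients of norm at least \<open>\<epsilon>\<close> are finitely many;
      by disjointness, dropping all others changes the sum by at most \<open>\<epsilon>\<close> at
      each point.\<close>
    define F where "F = {\<alpha> \<in> I. \<epsilon> \<le> norm (a \<alpha>)}"
    have F: "finite F" "F \<subseteq> I" using c0_finite[OF a \<epsilon>] by (auto simp: F_def)
    define g where "g i = (\<Sum>\<alpha>\<in>F. a \<alpha> * f \<alpha> i)" for i
    have "norm (S a i - g i) \<le> \<epsilon>" for i
    proof (cases "\<exists>\<alpha>\<in>I. f \<alpha> i \<noteq> 0")
      case True
      then obtain \<alpha> where \<alpha>: "\<alpha> \<in> I" "f \<alpha> i \<noteq> 0" by blast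
      have "g i = (\<Sum>\<beta>\<in>F. if \<beta> = \<alpha> then a \<alpha> * f \<alpha> i else 0)"
        unfolding g_def using disj[OF \<alpha>(1) _ \<alpha>(2)] F(2) by (intro sum.cong) auto
      also have "\<dots> = (if \<alpha> \<in> F then a \<alpha> * f \<alpha> i else 0)" using F(1) by simp
      finally have g: "g i = (if \<alpha> \<in> F then a \<alpha> * f \<alpha> i else 0)" .
      show ?thesis
      proof (cases "\<alpha> \<in> F")
        case True
        then show ?thesis using S_on[OF \<alpha>] g \<epsilon> by simp
      next
        case False
        then have "norm (a \<alpha>) \<le> \<epsilon>" using \<alpha> by (simp add: F_def)
        then have "norm (a \<alpha>) * norm (f \<alpha> i) \<le> \<epsilon> * 1" using f1[OF \<alpha>(1)] \<epsilon> by (intro mult_mono) auto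
        then show ?thesis using S_on[OF \<alpha>] g False by (simp add: norm_mult)
      qed
    next
      case False
      then have "g i = 0" using F(2) by (auto simp: g_def intro!: sum.neutral)
      then show ?thesis using S_off[OF a, of i] False \<epsilon> by simp
    qed
    moreover have "g \<in> vecs X" unfolding g_def using f(1) F(2) by (intro sum_X) auto
    ultimately show "\<exists>g\<in>vecs X. \<forall>i. norm (S a i - g i) \<le> \<epsilon>" by blast
  qed
  have norm_S: "sup_norm (S a) = sup_norm a" if a: "a \<in> vecs (c0 I)" for a
  proof (rule antisym)
    show "sup_norm (S a) \<le> sup_norm a"
    proof (rule sup_norm_le)
      fix i
      show "norm (S a i) \<le> sup_norm a"
      proof (cases "\<exists>\<alpha>\<in>I. f \<alpha> i \<noteq> 0")
        case True
        then obtain \<alpha> where \<alpha>: "\<alpha> \<in> I" "f \<alpha> i \<noteq> 0" by blast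
        have "norm (a \<alpha>) * norm (f \<alpha> i) \<le> sup_norm a * 1"
          using norm_le_sup_norm[OF c0_bounded[OF a]] f1[OF \<alpha>(1)] sup_norm_nonneg[OF c0_bounded[OF a]]
          by (intro mult_mono) auto
        then show ?thesis using S_on[OF \<alpha>] by (simp add: norm_mult)
      next
        case False
        then show ?thesis using S_off[OF a, of i] sup_norm_nonneg[OF c0_bounded[OF a]] by simp
      qed
    qed
    show "sup_norm a \<le> sup_norm (S a)"
    proof (rule sup_norm_le)
      fix \<alpha>
      show "norm (a \<alpha>) \<le> sup_norm (S a)"
      proof (cases "\<alpha> \<in> I")
        case True
        have bS: "bounded (range (S a))" using SX[OF a] by simp
        have "norm (a \<alpha> * f \<alpha> i) \<le> sup_norm (S a)" for i
          using S_on[OF True, of i a] norm_le_sup_norm[OF bS, of i] sup_norm_nonneg[OF bS]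
          by (cases "f \<alpha> i = 0") auto
        then have "sup_norm (\<lambda>i. a \<alpha> * f \<alpha> i) \<le> sup_norm (S a)" by (rule sup_norm_le)
        then show ?thesis using sup_norm_cmult[OF bounded_X[OF f(1)[OF True]], of "a \<alpha>"] f(2)[OF True] by simp
      next
        case False
        then show ?thesis using c0_off[OF a] sup_norm_nonneg[OF bounded_X[OF SX[OF a]]] by simp
      qed
    qed
  qed
  \<comment> \<open>The supremum 1 need not be attained, so a point with value above
    \<open>1 / 2\<close> is used to read off the coefficient of \<open>f \<alpha>\<close>.\<close>
  have "\<exists>i. norm (f \<alpha> i) > 1 / 2" if "\<alpha> \<in> I" for \<alpha>
  proof (rule ccontr)
    assume "\<not> ?thesis"
    then have "sup_norm (f \<alpha>) \<le> 1 / 2" by (intro sup_norm_le) (simp add: not_less)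
    then show False using f(2)[OF that] by simp
  qed
  then obtain \<gamma> where \<gamma>: "\<And>\<alpha>. \<alpha> \<in> I \<Longrightarrow> norm (f \<alpha> (\<gamma> \<alpha>)) > 1 / 2" by metis
  have \<gamma>0: "f \<alpha> (\<gamma> \<alpha>) \<noteq> 0" if "\<alpha> \<in> I" for \<alpha> using \<gamma>[OF that] by auto
  define T where "T y = (\<lambda>\<alpha>. if \<alpha> \<in> I then y (\<gamma> \<alpha>) / f \<alpha> (\<gamma> \<alpha>) else 0)" for y
  have TS: "T (S a) = a" if "a \<in> vecs (c0 I)" for a
    using S_on \<gamma>0 c0_off[OF that] by (auto simp: T_def fun_eq_iff)
  define Y where "Y = \<lparr>vecs = S ` vecs (c0 I), vnorm = sup_norm :: ('g \<Rightarrow> 'k) \<Rightarrow> real\<rparr>"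
  have Y: "vecs Y = S ` vecs (c0 I)" "vnorm Y = sup_norm" by (simp_all add: Y_def)
  have limit: "y \<in> vecs Y" if y: "y \<in> vecs X"
    and lim: "\<And>\<epsilon>. \<epsilon> > 0 \<Longrightarrow> \<exists>g\<in>vecs Y. sup_norm (\<lambda>i. y i - g i) < \<epsilon>" for y
  proof -
    \<comment> \<open>The candidate coefficients of \<open>y\<close>. Division by
      \<open>f \<alpha> (\<gamma> \<alpha>)\<close>, of norm above \<open>1 / 2\<close>, causes the
      factor 2 in the estimates below; being a uniform limit of members of \<open>c0 I\<close> puts
      \<open>b\<close> in \<open>c0 I\<close>.\<close>
    define b where "b = T y"
    have approx: "\<exists>a\<in>vecs (c0 I). (\<forall>i. norm (y i - S a i) \<le> \<epsilon>) \<and> (\<forall>\<alpha>. norm (b \<alpha> - a \<alpha>) \<le> 2 * \<epsilon>)"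
      if \<epsilon>: "\<epsilon> > 0" for \<epsilon>
    proof -
      obtain a where a: "a \<in> vecs (c0 I)" "sup_norm (\<lambda>i. y i - S a i) < \<epsilon>" using lim[OF \<epsilon>] by (auto simp: Y)
      have 1: "norm (y i - S a i) \<le> \<epsilon>" for i
        using norm_le_sup_norm[of "\<lambda>i. y i - S a i" i] y SX[OF a(1)] a(2) by simp
      have "norm (b \<alpha> - a \<alpha>) \<le> 2 * \<epsilon>" for \<alpha>
      proof (cases "\<alpha> \<in> I")
        case True
        have "b \<alpha> - a \<alpha> = (y (\<gamma> \<alpha>) - S a (\<gamma> \<alpha>)) / f \<alpha> (\<gamma> \<alpha>)"
          using True S_on[OF True \<gamma>0[OF True]] \<gamma>0[OF True] by (simp add: b_def T_def field_simps)
        then have "norm (b \<alpha> - a \<alpha>) = norm (y (\<gamma> \<alpha>) - S a (\<gamma> \<alpha>)) / norm (f \<alpha> (\<gamma> \<alpha>))"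
          by (simp add: norm_divide)
        also have "\<dots> \<le> \<epsilon> / (1 / 2)"
          using 1[of "\<gamma> \<alpha>"] \<gamma>[OF True] \<epsilon> by (intro frac_le) auto
        finally show ?thesis by simp
      next
        case False
        then show ?thesis using c0_off[OF a(1)] \<epsilon> by (simp add: b_def T_def)
      qed
      then show ?thesis using a(1) 1 by blast
    qed
    have "finite {\<alpha> \<in> I. norm (b \<alpha>) \<ge> e}" if e: "e > 0" for e
    proof -
      obtain a where a: "a \<in> vecs (c0 I)" "\<And>\<alpha>. norm (b \<alpha> - a \<alpha>) \<le> 2 * (e / 4)"
        using approx[of "e / 4"] e by auto
      have "norm (b \<alpha>) \<ge> e \<Longrightarrow> norm (a \<alpha>) \<ge> e / 2" for \<alpha>
        using a(2)[of \<alpha>] norm_triangle_sub[of "b \<alpha>" "a \<alpha>"] by simp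
      then have "{\<alpha> \<in> I. norm (b \<alpha>) \<ge> e} \<subseteq> {\<alpha> \<in> I. norm (a \<alpha>) \<ge> e / 2}" by blast
      then show ?thesis using c0_finite[OF a(1), of "e / 2"] e by (auto intro: finite_subset)
    qed
    then have b: "b \<in> vecs (c0 I)" by (simp add: c0_def b_def T_def)
    have "norm (y i - S b i) \<le> 0" for i
    proof (rule field_le_epsilon)
      fix e :: real assume e: "e > 0"
      obtain a where a: "a \<in> vecs (c0 I)" "\<And>i. norm (y i - S a i) \<le> e / 3" "\<And>\<alpha>. norm (b \<alpha> - a \<alpha>) \<le> 2 * (e / 3)"
        using approx[of "e / 3"] e by auto
      have "norm (S a i - S b i) \<le> sup_norm (S (\<lambda>\<alpha>. b \<alpha> - a \<alpha>))"
        using norm_le_sup_norm[OF bounded_X[OF SX[OF c0_diff[OF b a(1)]]], of i]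
        by (simp add: S_diff norm_minus_commute)
      also have "\<dots> \<le> 2 * (e / 3)"
        unfolding norm_S[OF c0_diff[OF b a(1)]] by (rule sup_norm_le) (rule a(3))
      finally show "norm (y i - S b i) \<le> 0 + e"
        using a(2)[of i] norm_triangle_ineq[of "y i - S a i" "S a i - S b i"] by simp
    qed
    then have "y = S b" by (simp add: fun_eq_iff)
    then show ?thesis using b by (auto simp: Y)
  qed
  have Yadd: "(\<lambda>i. g i + h i) \<in> vecs Y" if "g \<in> vecs Y" "h \<in> vecs Y" for g h
    using that by (auto simp: Y S_add[symmetric] c0_add)
  have Ycm: "(\<lambda>i. c * g i) \<in> vecs Y" if "g \<in> vecs Y" for g c
    using that by (auto simp: Y S_cmult[symmetric] c0_cmult)
  have "(\<lambda>i. 0) = S (\<lambda>\<alpha>. 0)" by (rule ext) (simp add: S_def)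
  then have Y0: "(\<lambda>i. 0) \<in> vecs Y" by (auto simp: Y intro!: c0_finite_support[of "{}"])
  have "closedin (norm_topology X) (vecs Y)"
    by (subst closedin_norm_topology_iff) (use limit SX in \<open>auto simp: Y\<close>)
  then have "closed_subspace Y X"
    unfolding closed_subspace_def using Yadd Ycm Y0 SX by (auto simp: Y)
  moreover have "isometrically_isomorphic Y (c0 I)"
    unfolding isometrically_isomorphic_def
  proof (intro exI[of _ T] conjI)
    show "bounded_operator Y (c0 I) T"
      unfolding bounded_operator_def
    proof (intro conjI)
      show "T ` vecs Y \<subseteq> vecs (c0 I)" by (auto simp: Y TS)
      show "\<exists>C. \<forall>g\<in>vecs Y. vnorm (c0 I) (T g) \<le> C * vnorm Y g"
        by (intro exI[of _ 1]) (auto simp: Y TS norm_S)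
    qed (auto simp: T_def fun_eq_iff add_divide_distrib)
    show "bij_betw T (vecs Y) (vecs (c0 I))"
      by (rule bij_betw_byWitness[of _ S]) (auto simp: Y TS)
    show "\<forall>g\<in>vecs Y. vnorm (c0 I) (T g) = vnorm Y g" by (auto simp: Y TS norm_S)
  qed
  ultimately show ?thesis by blast
qed

end

section \<open>Weakly Lindelof determined subspaces\<close>

context linf_c_subspace
begin

lemma dual_lin_comb:
  assumes "\<phi> \<in> vecs (dual_space X)" "\<psi> \<in> vecs (dual_space X)"
  shows "(\<lambda>f. \<phi> f + \<psi> f) \<in> vecs (dual_space X)" "(\<lambda>f. c * \<phi> f) \<in> vecs (dual_space X)"
    "(\<lambda>f. 0) \<in> vecs (dual_space X)"
proof -
  obtain A where A: "\<And>f. f \<in> vecs X \<Longrightarrow> norm (\<phi> f) \<le> A * sup_norm f" using assms(1) unfolding dual_iff by blast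
  obtain B where B: "\<And>f. f \<in> vecs X \<Longrightarrow> norm (\<psi> f) \<le> B * sup_norm f" using assms(2) unfolding dual_iff by blast
  have "norm (\<phi> f + \<psi> f) \<le> (A + B) * sup_norm f" if "f \<in> vecs X" for f
    using A[OF that] B[OF that] norm_triangle_ineq[of "\<phi> f" "\<psi> f"] by (simp add: distrib_right)
  then show "(\<lambda>f. \<phi> f + \<psi> f) \<in> vecs (dual_space X)"
    using assms unfolding dual_iff by (intro conjI exI[of _ "A + B"]) (simp_all add: algebra_simps)
  have "norm (c * \<phi> f) \<le> (norm c * A) * sup_norm f" if "f \<in> vecs X" for f
    using mult_left_mono[OF A[OF that], of "norm c"] by (simp add: norm_mult mult.assoc)
  then show "(\<lambda>f. c * \<phi> f) \<in> vecs (dual_space X)"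
    using assms(1) unfolding dual_iff by (intro conjI exI[of _ "norm c * A"]) (simp_all add: algebra_simps)
  show "(\<lambda>f. 0) \<in> vecs (dual_space X)" unfolding dual_iff by (auto intro!: exI[of _ 0])
qed

text \<open>This is the fact that a linear form vanishing on the common kernel of finitely many
  forms is a combination of them. The induction removes a vector \<open>f\<close> by passing to the
  functionals in \<open>V\<close> that vanish at \<open>f\<close>, which is why \<open>V\<close>
  varies.\<close>

lemma functional_is_evaluation:
  assumes "finite F" "F \<subseteq> vecs X" "V \<subseteq> vecs (dual_space X)"
    and V_add: "\<And>\<phi> \<psi>. \<phi> \<in> V \<Longrightarrow> \<psi> \<in> V \<Longrightarrow> (\<lambda>f. \<phi> f + \<psi> f) \<in> V"
    and V_cmult: "\<And>c \<phi>. \<phi> \<in> V \<Longrightarrow> (\<lambda>f. c * \<phi> f) \<in> V"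
    and add: "\<And>\<phi> \<psi>. \<phi> \<in> V \<Longrightarrow> \<psi> \<in> V \<Longrightarrow> \<Phi> (\<lambda>f. \<phi> f + \<psi> f) = \<Phi> \<phi> + \<Phi> \<psi>"
    and cmult: "\<And>c \<phi>. \<phi> \<in> V \<Longrightarrow> \<Phi> (\<lambda>f. c * \<phi> f) = c * \<Phi> \<phi>"
    and ker: "\<And>\<phi>. \<phi> \<in> V \<Longrightarrow> (\<And>f. f \<in> F \<Longrightarrow> \<phi> f = 0) \<Longrightarrow> \<Phi> \<phi> = 0"
  shows "\<exists>x\<in>vecs X. \<forall>\<phi>\<in>V. \<Phi> \<phi> = \<phi> x"
  using assms
proof (induction F arbitrary: V)
  case empty
  then show ?case by (intro bexI[of _ "\<lambda>i. 0"]) (auto simp: dual_zero)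
next
  case (insert f F)
  define V' where "V' = {\<phi> \<in> V. \<phi> f = 0}"
  have "\<exists>x\<in>vecs X. \<forall>\<phi>\<in>V'. \<Phi> \<phi> = \<phi> x"
  proof (rule insert.IH)
    fix \<phi> assume \<phi>: "\<phi> \<in> V'" and F: "\<And>g. g \<in> F \<Longrightarrow> \<phi> g = 0"
    show "\<Phi> \<phi> = 0"
    proof (rule insert.prems(7))
      show "\<phi> \<in> V" using \<phi> by (simp add: V'_def)
      show "\<phi> g = 0" if "g \<in> insert f F" for g
        using that \<phi> F by (auto simp: V'_def)
    qed
  qed (use insert.prems(1-6) in \<open>auto simp: V'_def\<close>)
  then obtain x where x: "x \<in> vecs X" "\<And>\<phi>. \<phi> \<in> V \<Longrightarrow> \<phi> f = 0 \<Longrightarrow> \<Phi> \<phi> = \<phi> x" by (auto simp: V'_def)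
  have f: "f \<in> vecs X" using insert.prems by simp
  show ?case
  proof (cases "\<exists>\<psi>\<in>V. \<psi> f \<noteq> 0")
    case False
    then show ?thesis using x by blast
  next
    case True
    then obtain \<psi> where \<psi>: "\<psi> \<in> V" "\<psi> f \<noteq> 0" by blast
    \<comment> \<open>Chosen so that evaluation at \<open>x + c * f\<close> is correct at
      \<open>\<psi>\<close>. It is then correct on all of \<open>V\<close>, since adding the
      multiple \<open>r * \<psi>\<close> to \<open>\<phi>\<close> produces a functional that
      vanishes at \<open>f\<close>.\<close>
    define c where "c = (\<Phi> \<psi> - \<psi> x) / \<psi> f"
    have "\<Phi> \<phi> = \<phi> (\<lambda>i. x i + c * f i)" if \<phi>: "\<phi> \<in> V" for \<phi>
    proof -
      define r where "r = - (\<phi> f / \<psi> f)"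
      have r\<psi>: "(\<lambda>g. r * \<psi> g) \<in> V" by (rule insert.prems(4)[OF \<psi>(1)])
      have "\<Phi> (\<lambda>g. \<phi> g + r * \<psi> g) = \<phi> x + r * \<psi> x"
        using x(2)[OF insert.prems(3)[OF \<phi> r\<psi>]] \<psi>(2) by (simp add: r_def)
      moreover have "\<Phi> (\<lambda>g. \<phi> g + r * \<psi> g) = \<Phi> \<phi> + r * \<Phi> \<psi>"
        using insert.prems(5)[OF \<phi> r\<psi>] insert.prems(6)[OF \<psi>(1), of r] by simp
      ultimately have "\<Phi> \<phi> = \<phi> x - r * (\<Phi> \<psi> - \<psi> x)" by (simp add: algebra_simps)
      also have "\<dots> = \<phi> x + c * \<phi> f" by (simp add: r_def c_def)
      also have "\<dots> = \<phi> (\<lambda>i. x i + c * f i)"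
        using dual_add[OF _ x(1) cmult_X[OF f], of \<phi> c] dual_cmult[OF _ f, of \<phi> c] \<phi> insert.prems(2) by auto
      finally show ?thesis .
    qed
    moreover have "(\<lambda>i. x i + c * f i) \<in> vecs X" using x f by simp
    ultimately show ?thesis by blast
  qed
qed

text \<open>Continuity at 0 gives a basic neighbourhood that constrains only finitely many
  arguments. If \<open>\<phi>\<close> vanishes at these, all its multiples stay in the
  neighbourhood, so \<open>\<Phi>\<close> is bounded on a line and vanishes at
  \<open>\<phi>\<close>.\<close>

lemma weak_star_continuous_functional:
  assumes add: "\<And>\<phi> \<psi>. \<phi> \<in> vecs (dual_space X) \<Longrightarrow> \<psi> \<in> vecs (dual_space X) \<Longrightarrow> \<Phi> (\<lambda>f. \<phi> f + \<psi> f) = \<Phi> \<phi> + \<Phi> \<psi>"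
    and cmult: "\<And>c \<phi>. \<phi> \<in> vecs (dual_space X) \<Longrightarrow> \<Phi> (\<lambda>f. c * \<phi> f) = c * \<Phi> \<phi>"
    and cont: "continuous_on (vecs (dual_space X)) \<Phi>"
  shows "\<exists>x\<in>vecs X. \<forall>\<phi>\<in>vecs (dual_space X). \<Phi> \<phi> = \<phi> x"
proof -
  let ?D = "vecs (dual_space X)"
  have zero: "(\<lambda>f. 0) \<in> ?D" by (rule dual_lin_comb[OF coord_dual coord_dual])
  have \<Phi>0: "\<Phi> (\<lambda>f. 0) = 0" using cmult[OF zero, of 0] by simp
  obtain U where U: "open U" "?D \<inter> \<Phi> -` ball 0 1 = ?D \<inter> U"
    using continuous_openin_preimage_gen[OF cont open_ball, of 0 1] by (auto simp: openin_open)
  have "(\<lambda>f. 0) \<in> U" using U(2) zero \<Phi>0 by auto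
  then obtain W where W: "(\<lambda>f. 0) \<in> Pi\<^sub>E UNIV W" "finite {f. W f \<noteq> UNIV}" "Pi\<^sub>E UNIV W \<subseteq> U"
    using product_topology_open_contains_basis[OF U(1)[unfolded open_fun_def], of "\<lambda>f. 0"] by auto
  show ?thesis
  proof (rule functional_is_evaluation[where F = "{f. W f \<noteq> UNIV} \<inter> vecs X"])
    fix \<phi> assume \<phi>: "\<phi> \<in> ?D" and ker: "\<And>f. f \<in> {f. W f \<noteq> UNIV} \<inter> vecs X \<Longrightarrow> \<phi> f = 0"
    have small: "norm (t * \<Phi> \<phi>) < 1" for t
    proof -
      have "t * \<phi> f \<in> W f" for f
      proof (cases "W f = UNIV")
        case False
        then have "\<phi> f = 0" using ker[of f] \<phi> by (cases "f \<in> vecs X") (auto simp: dual_iff)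
        then show ?thesis using W(1) by (auto simp: PiE_iff)
      qed simp
      then have "(\<lambda>f. t * \<phi> f) \<in> U" using W(3) by (auto simp: PiE_iff)
      moreover have "(\<lambda>f. t * \<phi> f) \<in> ?D" by (rule dual_lin_comb(2)[OF \<phi> \<phi>])
      ultimately have "(\<lambda>f. t * \<phi> f) \<in> \<Phi> -` ball 0 1" using U(2) by blast
      then show ?thesis using cmult[OF \<phi>] by simp
    qed
    show "\<Phi> \<phi> = 0"
    proof (rule ccontr)
      assume "\<Phi> \<phi> \<noteq> 0"
      then show False using small[of "inverse (\<Phi> \<phi>)"] by simp
    qed
  qed (use W add cmult dual_lin_comb in auto)
qed

text \<open>The vector \<open>x \<delta>\<close> represents coordinate \<open>\<delta>\<close> of
  the operator. The countability condition expresses that the image of \<open>coord i\<close> has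
  countable support, and totality expresses injectivity.\<close>

lemma WLD_total_family:
  assumes "WLD TYPE('d) X"
  obtains x :: "'d \<Rightarrow> 'g \<Rightarrow> 'k" where "\<And>\<delta>. x \<delta> \<in> vecs X" "\<And>i. countable {\<delta>. x \<delta> i \<noteq> 0}"
    "\<And>\<phi> y. \<phi> \<in> vecs (dual_space X) \<Longrightarrow> (\<And>\<delta>. \<phi> (x \<delta>) = 0) \<Longrightarrow> y \<in> vecs X \<Longrightarrow> \<phi> y = 0"
proof -
  let ?D = "vecs (dual_space X)"
  obtain \<Delta> :: "'d set" and T where T: "bounded_operator (dual_space X) (linf_c \<Delta>) T" "inj_on T ?D"
    "continuous_map (weak_star_topology X) (pointwise_topology (linf_c \<Delta>)) T"
    using assms by (auto simp: WLD_def)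
  have cont: "continuous_on ?D T"
    using T(3) by (simp add: weak_star_topology_def pointwise_topology_def)
  have "\<exists>x\<in>vecs X. \<forall>\<phi>\<in>?D. T \<phi> \<delta> = \<phi> x" for \<delta>
  proof (rule weak_star_continuous_functional)
    show "continuous_on ?D (\<lambda>\<phi>. T \<phi> \<delta>)" by (rule continuous_on_product_then_coordinatewise[OF cont])
  qed (simp_all add: bounded_operator_add[OF T(1)] bounded_operator_cmult[OF T(1)])
  then obtain x where x: "\<And>\<delta>. x \<delta> \<in> vecs X" "\<And>\<delta> \<phi>. \<phi> \<in> ?D \<Longrightarrow> T \<phi> \<delta> = \<phi> (x \<delta>)" by metis
  show thesis
  proof
    show "x \<delta> \<in> vecs X" for \<delta> by (rule x)
    show "countable {\<delta>. x \<delta> i \<noteq> 0}" for i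
    proof -
      have eq: "T (coord i) \<delta> = x \<delta> i" for \<delta> using x(2)[OF coord_dual] x(1) by (simp add: coord_def)
      have "T (coord i) \<in> vecs (linf_c \<Delta>)" by (rule bounded_operator_mem[OF T(1) coord_dual])
      then have c: "countable {\<delta> \<in> \<Delta>. x \<delta> i \<noteq> 0}" and off: "\<And>\<delta>. \<delta> \<notin> \<Delta> \<Longrightarrow> x \<delta> i = 0"
        by (auto simp: linf_c_def eq)
      have "{\<delta>. x \<delta> i \<noteq> 0} \<subseteq> {\<delta> \<in> \<Delta>. x \<delta> i \<noteq> 0}" using off by force
      then show ?thesis using c by (rule countable_subset)
    qed
    fix \<phi> y assume \<phi>: "\<phi> \<in> ?D" "\<And>\<delta>. \<phi> (x \<delta>) = 0"
    have zero: "(\<lambda>f. 0) \<in> ?D" by (rule dual_lin_comb[OF coord_dual coord_dual])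
    have "T \<phi> = T (\<lambda>f. 0)"
      using x(2)[OF \<phi>(1)] x(2)[OF zero] \<phi>(2) by (simp add: fun_eq_iff)
    then have "\<phi> = (\<lambda>f. 0)" using inj_onD[OF T(2)] \<phi>(1) zero by blast
    then show "\<phi> y = 0" by simp
  qed
qed

text \<open>Zorn's lemma is applied to sets of indices rather than of vectors, so two indices of the
  same nonzero vector never occur together. A countable maximal set would leave only countably many
  nonzero \<open>x \<delta>\<close> in total, contradicting nonseparability.\<close>

theorem WLD_nonseparable_contains_c0:
  assumes "WLD TYPE('d) X" "\<not> separable X"
  shows "\<exists>Y. closed_subspace Y X \<and> isometrically_isomorphic Y (c0 omega1)"
proof -
  obtain x :: "'d \<Rightarrow> 'g \<Rightarrow> 'k" where x: "\<And>\<delta>. x \<delta> \<in> vecs X" "\<And>i. countable {\<delta>. x \<delta> i \<noteq> 0}"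
    "\<And>\<phi> y. \<phi> \<in> vecs (dual_space X) \<Longrightarrow> (\<And>\<delta>. \<phi> (x \<delta>) = 0) \<Longrightarrow> y \<in> vecs X \<Longrightarrow> \<phi> y = 0"
    using WLD_total_family[OF assms(1)] by blast
  define \<A> where "\<A> = {F. (\<forall>\<delta>\<in>F. \<exists>i. x \<delta> i \<noteq> 0) \<and>
    (\<forall>\<delta>\<in>F. \<forall>\<delta>'\<in>F. \<forall>i. x \<delta> i \<noteq> 0 \<longrightarrow> x \<delta>' i \<noteq> 0 \<longrightarrow> \<delta> = \<delta>')}"
  have "\<exists>M\<in>\<A>. \<forall>F\<in>\<A>. M \<subseteq> F \<longrightarrow> F = M"
  proof (rule subset_Zorn')
    fix C assume C: "subset.chain \<A> C"
    have eq: "\<delta> = \<delta>'" if "A \<in> C" "B \<in> C" "\<delta> \<in> A" "\<delta>' \<in> B" "x \<delta> i \<noteq> 0" "x \<delta>' i \<noteq> 0" for A B \<delta> \<delta>' i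
    proof -
      have "A \<subseteq> B \<or> B \<subseteq> A" "A \<in> \<A>" "B \<in> \<A>" using C that by (auto simp: subset_chain_def)
      then show ?thesis using that unfolding \<A>_def by blast
    qed
    have ne: "\<exists>i. x \<delta> i \<noteq> 0" if "\<delta> \<in> A" "A \<in> C" for \<delta> A
    proof -
      have "A \<in> \<A>" using C that(2) by (auto simp: subset_chain_def)
      then show ?thesis using that(1) by (simp add: \<A>_def)
    qed
    show "\<Union>C \<in> \<A>"
      unfolding \<A>_def using ne eq by (intro CollectI conjI ballI allI impI; elim UnionE)
  qed
  then obtain M where M: "M \<in> \<A>" "\<And>F. F \<in> \<A> \<Longrightarrow> M \<subseteq> F \<Longrightarrow> F = M" by blast
  have "uncountable M"
  proof
    assume "countable M"
    \<comment> \<open>\<open>A\<close> is the set covered by the supports of the family, and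
      \<open>E\<close> collects the indices whose support meets \<open>A\<close>. A nonzero
      \<open>x \<delta>\<close> with \<open>\<delta>\<close> outside \<open>E\<close> could be added
      to \<open>M\<close>, so \<open>E\<close> contains all indices of nonzero vectors.\<close>
    define A where "A = (\<Union>\<delta>\<in>M. {i. x \<delta> i \<noteq> 0})"
    define E where "E = (\<Union>i\<in>A. {\<delta>. x \<delta> i \<noteq> 0})"
    have "countable A" unfolding A_def using \<open>countable M\<close> countable_support_X x(1) by (intro countable_UN) auto
    then have "countable E" unfolding E_def using x(2) by (intro countable_UN) auto
    have E: "\<delta> \<in> E" if "x \<delta> j \<noteq> 0" for \<delta> j
    proof (rule ccontr)
      assume "\<delta> \<notin> E"
      then have off: "x \<delta> i = 0" if "\<delta>' \<in> M" "x \<delta>' i \<noteq> 0" for \<delta>' i using that by (auto simp: A_def E_def)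
      have "insert \<delta> M \<in> \<A>"
        unfolding \<A>_def
      proof (intro CollectI conjI ballI allI impI)
        show "\<exists>i. x \<delta>' i \<noteq> 0" if "\<delta>' \<in> insert \<delta> M" for \<delta>'
          using that M(1) \<open>x \<delta> j \<noteq> 0\<close> unfolding \<A>_def by blast
        show "\<alpha> = \<beta>" if "\<alpha> \<in> insert \<delta> M" "\<beta> \<in> insert \<delta> M" "x \<alpha> i \<noteq> 0" "x \<beta> i \<noteq> 0" for \<alpha> \<beta> i
          using that M(1) off[of \<alpha> i] off[of \<beta> i] unfolding \<A>_def by blast
      qed
      then have "\<delta> \<in> M" using M(2) by blast
      then show False using off that by blast
    qed
    have "separable X"
    proof (rule separable_if_total)
      show "countable (x ` E)" using \<open>countable E\<close> by simp
      show "x ` E \<subseteq> vecs X" using x(1) by blast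
      fix \<phi> y assume \<phi>: "\<phi> \<in> vecs (dual_space X)" and ann: "\<And>d. d \<in> x ` E \<Longrightarrow> \<phi> d = 0" and y: "y \<in> vecs X"
      have "\<phi> (x \<delta>) = 0" for \<delta>
      proof (cases "\<exists>j. x \<delta> j \<noteq> 0")
        case True
        then show ?thesis using E ann by blast
      next
        case False
        then have "x \<delta> = (\<lambda>i. 0)" by auto
        then show ?thesis using dual_zero[OF \<phi>] by simp
      qed
      then show "\<phi> y = 0" using x(3) \<phi> y by blast
    qed
    then show False using assms(2) by blast
  qed
  then obtain h where h: "inj_on h omega1" "h ` omega1 \<subseteq> M" using omega1_inj_into_uncountable by blast
  define f where "f \<alpha> = (\<lambda>i. inverse (of_real (sup_norm (x (h \<alpha>)))) * x (h \<alpha>) i)" for \<alpha>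
  have pos: "sup_norm (x (h \<alpha>)) > 0" if "\<alpha> \<in> omega1" for \<alpha>
  proof -
    have "x (h \<alpha>) \<noteq> (\<lambda>i. 0)" using h(2) M(1) that by (force simp: \<A>_def)
    then show ?thesis
      using sup_norm_eq_0[OF bounded_X[OF x(1)], of "h \<alpha>"] sup_norm_nonneg[OF bounded_X[OF x(1)], of "h \<alpha>"] by simp
  qed
  show ?thesis
  proof (rule isometric_c0_of_disjoint_family[of omega1 f])
    fix \<alpha> assume \<alpha>: "\<alpha> \<in> omega1"
    show "f \<alpha> \<in> vecs X" using x(1) by (simp add: f_def)
    show "sup_norm (f \<alpha>) = 1"
      unfolding f_def using sup_norm_cmult[OF bounded_X[OF x(1)], of "inverse (of_real (sup_norm (x (h \<alpha>))))" "h \<alpha>"]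
        pos[OF \<alpha>] by (simp add: norm_inverse)
    fix \<beta> i assume \<beta>: "\<beta> \<in> omega1" "f \<alpha> i \<noteq> 0" "f \<beta> i \<noteq> 0"
    then have "h \<alpha> = h \<beta>" using M(1) h(2) \<alpha> by (auto simp: f_def \<A>_def image_subset_iff)
    then show "\<alpha> = \<beta>" using inj_onD[OF h(1)] \<alpha> \<beta>(1) by blast
  qed
qed

end

section \<open>Reflexive subspaces\<close>

context linf_c_subspace
begin

lemma norm_le_dual_norm:
  assumes \<phi>: "\<phi> \<in> vecs (dual_space X)" and f: "f \<in> vecs X" "sup_norm f \<le> 1"
  shows "norm (\<phi> f) \<le> vnorm (dual_space X) \<phi>"
proof -
  obtain C where C: "\<And>g. g \<in> vecs X \<Longrightarrow> norm (\<phi> g) \<le> C * sup_norm g" using \<phi> unfolding dual_iff by blast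
  have "norm (\<phi> g) \<le> \<bar>C\<bar>" if g: "g \<in> vecs X" "sup_norm g \<le> 1" for g
  proof -
    have "C * sup_norm g \<le> \<bar>C\<bar> * 1"
      using g sup_norm_nonneg[OF bounded_X[OF g(1)]] by (intro mult_mono) auto
    then show ?thesis using C[OF g(1)] by simp
  qed
  then have "bdd_above ((\<lambda>g. norm (\<phi> g)) ` {g \<in> vecs X. sup_norm g \<le> 1})" by (intro bdd_aboveI2) auto
  then show ?thesis using f unfolding dual_space_def by (auto intro: cSUP_upper)
qed

lemma coord_dual_norm: "vnorm (dual_space X) (coord i) \<le> 1"
proof -
  have "(\<lambda>i. 0) \<in> {f \<in> vecs X. sup_norm f \<le> 1}" by (simp add: sup_norm_def)
  moreover have "norm (coord i f) \<le> 1" if "f \<in> {f \<in> vecs X. sup_norm f \<le> 1}" for f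
    using that norm_le_sup_norm[of f i] by (auto simp: coord_def)
  ultimately show ?thesis unfolding dual_space_def by (auto intro!: cSUP_least)
qed

text \<open>The unit ball of the bidual, written as a conjunction of conditions that are closed
  under pointwise convergence; the norm bound is stated separately at each functional.\<close>

definition bidual_ball :: "((('g \<Rightarrow> 'k) \<Rightarrow> 'k) \<Rightarrow> 'k) set" where
  "bidual_ball = {\<xi>. (\<forall>\<phi>\<in>- vecs (dual_space X). \<xi> \<phi> = 0) \<and>
     (\<forall>\<phi>\<in>vecs (dual_space X). \<forall>\<psi>\<in>vecs (dual_space X). \<xi> (\<lambda>f. \<phi> f + \<psi> f) = \<xi> \<phi> + \<xi> \<psi>) \<and>
     (\<forall>c. \<forall>\<phi>\<in>vecs (dual_space X). \<xi> (\<lambda>f. c * \<phi> f) = c * \<xi> \<phi>) \<and>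
     (\<forall>\<phi>\<in>vecs (dual_space X). norm (\<xi> \<phi>) \<le> vnorm (dual_space X) \<phi>)}"

text \<open>The Banach-Alaoglu argument: a closed subset of a product of closed balls, which is
  compact by Tychonoff.\<close>

lemma compact_bidual_ball: "compact bidual_ball"
proof -
  let ?D = "vecs (dual_space X)"
  let ?P = "Pi\<^sub>E UNIV (\<lambda>\<phi>. cball 0 (if \<phi> \<in> ?D then vnorm (dual_space X) \<phi> else 0) :: 'k set)"
  have "compactin (product_topology (\<lambda>\<phi>::('g \<Rightarrow> 'k) \<Rightarrow> 'k. euclidean :: 'k topology) UNIV) ?P"
    unfolding compactin_PiE by simp
  then have "compact ?P" by (simp add: euclidean_product_topology)
  moreover have "closed bidual_ball"
    unfolding bidual_ball_def
    by (simp only: Collect_conj_eq Collect_ball_eq Collect_all_eq)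
      (intro closed_Int closed_INT ballI closed_Collect_eq closed_Collect_le continuous_intros
        continuous_on_product_coordinates)
  ultimately have "compact (?P \<inter> bidual_ball)" by (rule compact_Int_closed)
  moreover have "bidual_ball \<subseteq> ?P" by (auto simp: bidual_ball_def PiE_iff)
  ultimately show ?thesis by (simp add: Int_absorb1)
qed

lemma canonical_map_ball:
  assumes "f \<in> vecs X" "sup_norm f \<le> 1"
  shows "canonical_map X f \<in> bidual_ball"
  using assms norm_le_dual_norm unfolding bidual_ball_def
  by (auto simp: canonical_map_def dual_lin_comb)

lemma reflexive_bidual_ball:
  assumes "reflexive X" "\<xi> \<in> bidual_ball"
  obtains f where "f \<in> vecs X" "\<xi> = canonical_map X f"
proof -
  have "\<xi> \<in> vecs (dual_space (dual_space X))"
    using assms(2) unfolding bidual_ball_def dual_space_def[of "dual_space X"]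
    by (auto intro!: exI[of _ 1])
  then show thesis using assms(1) that unfolding reflexive_def by blast
qed

text \<open>A cluster point of the canonical images exists by compactness and comes from a vector by
  reflexivity. No subsequence is extracted, so its value is determined only at functionals along
  which the whole sequence converges.\<close>

lemma reflexive_weak_limit:
  assumes "reflexive X" and s: "\<And>n. s n \<in> vecs X" "\<And>n. sup_norm (s n) \<le> 1"
  obtains y where "y \<in> vecs X"
    "\<And>\<phi> L. \<phi> \<in> vecs (dual_space X) \<Longrightarrow> (\<lambda>n. \<phi> (s n)) \<longlonglongrightarrow> L \<Longrightarrow> \<phi> y = L"
proof -
  define F where "F = filtermap (\<lambda>n. canonical_map X (s n)) sequentially"
  have "F \<noteq> bot" by (simp add: F_def filtermap_bot_iff)
  moreover have "eventually (\<lambda>\<xi>. \<xi> \<in> bidual_ball) F"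
    unfolding F_def eventually_filtermap using canonical_map_ball s by simp
  ultimately obtain \<xi> where \<xi>: "\<xi> \<in> bidual_ball" "inf (nhds \<xi>) F \<noteq> bot"
    using compact_bidual_ball unfolding compact_filter by blast
  obtain y where y: "y \<in> vecs X" "\<xi> = canonical_map X y"
    using reflexive_bidual_ball[OF assms(1) \<xi>(1)] by blast
  have "\<phi> y = L" if \<phi>: "\<phi> \<in> vecs (dual_space X)" and L: "(\<lambda>n. \<phi> (s n)) \<longlonglongrightarrow> L" for \<phi> L
  proof -
    have "((\<lambda>\<zeta>. \<zeta> \<phi>) \<longlongrightarrow> L) F"
      unfolding F_def filterlim_filtermap using L \<phi> by (simp add: canonical_map_def)
    \<comment> \<open>Along the common refinement of the neighbourhoods of \<open>\<xi>\<close> and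
      \<open>F\<close>, which is a proper filter, evaluation at \<open>\<phi>\<close> tends both to
      \<open>L\<close> and to \<open>\<xi> \<phi>\<close>.\<close>
    then have 1: "((\<lambda>\<zeta>. \<zeta> \<phi>) \<longlongrightarrow> L) (inf (nhds \<xi>) F)" by (rule tendsto_mono[rotated]) simp
    have "((\<lambda>\<zeta>. \<zeta> \<phi>) \<longlongrightarrow> \<xi> \<phi>) (at \<xi>)"
      using continuous_on_product_coordinates[of \<phi>] unfolding continuous_on_def by blast
    then have "((\<lambda>\<zeta>. \<zeta> \<phi>) \<longlongrightarrow> \<xi> \<phi>) (nhds \<xi>)"
      by (rule tendsto_at_iff_tendsto_nhds[THEN iffD1])
    then have 2: "((\<lambda>\<zeta>. \<zeta> \<phi>) \<longlongrightarrow> \<xi> \<phi>) (inf (nhds \<xi>) F)" by (rule tendsto_mono[rotated]) simp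
    have "\<xi> \<phi> = L" by (rule tendsto_unique[OF \<xi>(2) 2 1])
    then show ?thesis using y \<phi> by (simp add: canonical_map_def)
  qed
  then show thesis using that y(1) by blast
qed

text \<open>A vector of the unit ball is approximated on \<open>A\<close> by a sequence from a
  countable set \<open>D\<close>. A weak cluster point of that sequence agrees with the vector on
  \<open>A\<close>, hence equals it, so a functional that vanishes on \<open>D\<close> vanishes on
  the ball.\<close>

lemma reflexive_separable_if_injective_restriction:
  assumes refl: "reflexive X" and A: "countable A"
    and inj: "\<And>x. x \<in> vecs X \<Longrightarrow> (\<And>i. i \<in> A \<Longrightarrow> x i = 0) \<Longrightarrow> x = (\<lambda>i. 0)"
  shows "separable X"
proof -
  define B where "B = {x \<in> vecs X. sup_norm x \<le> 1}"
  define r where "r x = (\<lambda>n::nat. x (from_nat_into A n))" for x :: "'g \<Rightarrow> 'k"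
  \<comment> \<open>The scalar sequences with pointwise convergence form a second countable space,
    so every subset, here the restricted unit ball, has a countable dense subset.\<close>
  obtain T where T: "countable T" "T \<subseteq> r ` B" "r ` B \<subseteq> closure T"
    using Topology_Euclidean_Space.separable[of "r ` B"] by blast
  obtain D where D: "countable D" "D \<subseteq> B" "T = r ` D"
    using T(1,2) by (metis countable_subset_image)
  show ?thesis
  proof (rule separable_if_total)
    show "countable D" by fact
    show "D \<subseteq> vecs X" using D(2) by (auto simp: B_def)
    fix \<phi> y assume \<phi>: "\<phi> \<in> vecs (dual_space X)" and ann: "\<And>d. d \<in> D \<Longrightarrow> \<phi> d = 0" and y: "y \<in> vecs X"
    have ball: "\<phi> z = 0" if z: "z \<in> B" for z
    proof -
      have "r z \<in> closure (r ` D)" using T(3) D(3) z by blast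
      then obtain t where t: "\<And>n. t n \<in> r ` D" "t \<longlonglongrightarrow> r z" unfolding closure_sequential by blast
      then have "\<forall>n. \<exists>d\<in>D. t n = r d" by blast
      then obtain d where d: "\<And>n. d n \<in> D" "\<And>n. t n = r (d n)" by metis
      have dX: "d n \<in> vecs X" "sup_norm (d n) \<le> 1" for n using d(1) D(2) by (auto simp: B_def)
      obtain w where w: "w \<in> vecs X"
        "\<And>\<psi> L. \<psi> \<in> vecs (dual_space X) \<Longrightarrow> (\<lambda>n. \<psi> (d n)) \<longlonglongrightarrow> L \<Longrightarrow> \<psi> w = L"
        by (rule reflexive_weak_limit[OF refl dX]) (rule that)
      have zX: "z \<in> vecs X" using z by (simp add: B_def)
      have "w i - z i = 0" if i: "i \<in> A" for i
      proof -
        obtain m where m: "from_nat_into A m = i" using from_nat_into_surj[OF A i] by blast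
        have "(\<lambda>n. t n m) \<longlonglongrightarrow> r z m"
          using continuous_on_tendsto_compose[OF continuous_on_product_coordinates[of m] t(2)] by simp
        then have "(\<lambda>n. coord i (d n)) \<longlonglongrightarrow> z i" using d(2) dX(1) m by (simp add: r_def coord_def)
        then have "coord i w = z i" by (rule w(2)[OF coord_dual])
        then show ?thesis using w(1) by (simp add: coord_def)
      qed
      then have "(\<lambda>i. w i - z i) = (\<lambda>i. 0)" by (intro inj diff_X w(1) zX)
      then have "w = z" by (simp add: fun_eq_iff)
      moreover have "\<phi> w = 0" by (rule w(2)[OF \<phi>]) (simp add: ann d(1))
      ultimately show ?thesis by simp
    qed
    define c :: 'k where "c = of_real (inverse (sup_norm y + 1))"
    have n: "0 \<le> sup_norm y" using y by (simp add: sup_norm_nonneg)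
    have "norm c = inverse (sup_norm y + 1)" using n unfolding c_def norm_of_real by simp
    then have "sup_norm (\<lambda>i. c * y i) \<le> 1"
      using n unfolding sup_norm_cmult[OF bounded_X[OF y]]
      by (simp add: divide_inverse[symmetric] mult.commute)
    then have "(\<lambda>i. c * y i) \<in> B" using y by (simp add: B_def)
    then have "c * \<phi> y = 0" using ball dual_cmult[OF \<phi> y] by metis
    moreover have "c \<noteq> 0" using n unfolding c_def of_real_eq_0_iff by simp
    ultimately show "\<phi> y = 0" by simp
  qed
qed

text \<open>The weak cluster point \<open>y\<close> of the partial sums agrees with every
  \<open>x k\<close> on the support of \<open>x k\<close>, and Hahn-Banach puts it in the closed
  span. A finite combination, however, vanishes on the support of some \<open>x N\<close>, where
  \<open>y\<close> still has supremum 1.\<close>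

lemma reflexive_no_disjoint_sequence:
  assumes refl: "reflexive X" and x: "\<And>n::nat. x n \<in> vecs X" "\<And>n. sup_norm (x n) = 1"
    and disj: "\<And>j k i. x j i \<noteq> 0 \<Longrightarrow> x k i \<noteq> 0 \<Longrightarrow> j = k"
  shows False
proof -
  define s where "s n = (\<lambda>i. \<Sum>k<n. x k i)" for n
  have s_eq: "s n i = (if k < n then x k i else 0)" if "x k i \<noteq> 0" for n i k
  proof -
    have "s n i = (\<Sum>j<n. if j = k then x k i else 0)"
      unfolding s_def using disj[OF that] by (intro sum.cong) auto
    then show ?thesis by simp
  qed
  have sX: "s n \<in> vecs X" for n unfolding s_def by (rule sum_X) (rule x)
  have "norm (s n i) \<le> 1" for n i
  proof (cases "\<exists>k. x k i \<noteq> 0")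
    case True
    then obtain k where k: "x k i \<noteq> 0" by blast
    show ?thesis using s_eq[OF k, of n] norm_le_sup_norm[OF bounded_X[OF x(1)], of k i] x(2) by simp
  next
    case False
    then show ?thesis by (simp add: s_def)
  qed
  then have s1: "sup_norm (s n) \<le> 1" for n by (rule sup_norm_le)
  obtain y where y: "y \<in> vecs X"
    "\<And>\<phi> L. \<phi> \<in> vecs (dual_space X) \<Longrightarrow> (\<lambda>n. \<phi> (s n)) \<longlonglongrightarrow> L \<Longrightarrow> \<phi> y = L"
    by (rule reflexive_weak_limit[OF refl sX s1]) (rule that)
  have y_eq: "y i = x k i" if "x k i \<noteq> 0" for i k
  proof -
    have "\<forall>\<^sub>F n in sequentially. coord i (s n) = x k i"
      using eventually_gt_at_top[of k] by eventually_elim (simp add: coord_def sX s_eq[OF that])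
    then have "coord i y = x k i" by (intro y(2) coord_dual tendsto_eventually)
    then show ?thesis using y(1) by (simp add: coord_def)
  qed
  \<comment> \<open>Any bound below 1 would serve, as each combination turns out to have distance at
    least 1 from \<open>y\<close>.\<close>
  have "\<exists>c\<in>combos UNIV (range x). sup_norm (\<lambda>i. y i - c i) < 1 / 2"
  proof (rule mem_closure_combos)
    show "range x \<subseteq> vecs X" "y \<in> vecs X" using x y by auto
    show "\<exists>q\<in>UNIV. norm (t - q) < \<epsilon>" if "\<epsilon> > 0" for t :: 'k and \<epsilon>
      using that by (intro bexI[of _ t]) auto
    fix \<phi> assume \<phi>: "\<phi> \<in> vecs (dual_space X)" and ann: "\<And>d. d \<in> range x \<Longrightarrow> \<phi> d = 0"
    have "\<phi> (s n) = 0" for n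
      unfolding s_def using dual_sum[OF \<phi>, of "{..<n}" x] x(1) ann by simp
    then show "\<phi> y = 0" by (intro y(2)[OF \<phi>]) simp
  qed simp
  then obtain c where c: "c \<in> combos UNIV (range x)" "sup_norm (\<lambda>i. y i - c i) < 1 / 2" by blast
  have "\<exists>N. \<forall>i. x N i \<noteq> 0 \<longrightarrow> c i = 0" 
  proof -
    \<comment> \<open>Strengthened to all large indices, so that a further vector \<open>x j\<close>
      in the combination is handled by raising \<open>N\<close> beyond \<open>j\<close>.\<close>
    have "\<exists>N. \<forall>k\<ge>N. \<forall>i. x k i \<noteq> 0 \<longrightarrow> c i = 0" using c(1)
    proof induction
      case (combos_step q d c)
      then obtain N j where N: "\<And>k i. k \<ge> N \<Longrightarrow> x k i \<noteq> 0 \<Longrightarrow> c i = 0" and j: "d = x j" by blast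
      have "q * d i + c i = 0" if "k \<ge> max N (Suc j)" "x k i \<noteq> 0" for k i
        using N[of k i] disj[of k i j] that j by auto
      then show ?case by blast
    qed simp
    then show ?thesis by blast
  qed
  then obtain N where N: "\<And>i. x N i \<noteq> 0 \<Longrightarrow> c i = 0" by blast
  have cX: "c \<in> vecs X" using combos_X[OF _ c(1)] x(1) by auto
  have "norm (x N i) \<le> sup_norm (\<lambda>i. y i - c i)" for i
  proof (cases "x N i = 0")
    case True
    then show ?thesis using sup_norm_nonneg[of "\<lambda>i. y i - c i"] y(1) cX by simp
  next
    case False
    then show ?thesis using norm_le_sup_norm[of "\<lambda>i. y i - c i" i] y(1) cX y_eq N by simp
  qed
  then have "sup_norm (x N) \<le> sup_norm (\<lambda>i. y i - c i)" by (rule sup_norm_le)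
  then show False using c(2) x(2) by simp
qed

text \<open>In a nonseparable \<open>X\<close> no countable set of coordinates determines the
  vectors, so one can keep choosing unit vectors that vanish on all earlier supports. This builds
  the disjoint sequence excluded above.\<close>

theorem reflexive_imp_separable:
  assumes refl: "reflexive X"
  shows "separable X"
proof (rule ccontr)
  assume nonsep: "\<not> separable X"
  have ex: "\<exists>x. x \<in> vecs X \<and> sup_norm x = 1 \<and> (\<forall>i\<in>A. x i = 0)" if A: "countable A" for A
  proof -
    obtain x where x: "x \<in> vecs X" "\<And>i. i \<in> A \<Longrightarrow> x i = 0" "x \<noteq> (\<lambda>i. 0)"
      using reflexive_separable_if_injective_restriction[OF refl A] nonsep by blast
    have "sup_norm x \<noteq> 0" using sup_norm_eq_0[OF bounded_X[OF x(1)]] x(3) by simp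
    then have "sup_norm (\<lambda>i. of_real (inverse (sup_norm x)) * x i) = 1"
      using sup_norm_cmult[OF bounded_X[OF x(1)], of "of_real (inverse (sup_norm x))"]
        sup_norm_nonneg[OF bounded_X[OF x(1)]] by (simp add: norm_inverse)
    then show ?thesis using x(1,2) by (intro exI[of _ "\<lambda>i. of_real (inverse (sup_norm x)) * x i"]) auto
  qed
  \<comment> \<open>The recursion carries a countable set of forbidden coordinates together with a
    unit vector vanishing on it. By \<open>R\<close>, the next forbidden set absorbs the present one
    and the support of the present vector.\<close>
  define P where "P (n::nat) Ax \<longleftrightarrow> countable (fst Ax) \<and> snd Ax \<in> vecs X \<and> sup_norm (snd Ax) = 1 \<and>
    (\<forall>i\<in>fst Ax. snd Ax i = 0)" for n and Ax :: "'g set \<times> ('g \<Rightarrow> 'k)"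
  define R where "R (n::nat) Ax By \<longleftrightarrow> fst Ax \<union> {i. snd Ax i \<noteq> 0} \<subseteq> fst By"
    for n and Ax By :: "'g set \<times> ('g \<Rightarrow> 'k)"
  have "\<exists>f. \<forall>n. P n (f n) \<and> R n (f n) (f (Suc n))"
  proof (rule dependent_nat_choice)
    show "\<exists>Ax. P 0 Ax" using ex[of "{}"] by (auto simp: P_def intro!: exI[of _ "{}"])
    fix Ax n assume "P n Ax"
    then have c: "countable (fst Ax \<union> {i. snd Ax i \<noteq> 0})" using countable_support_X by (simp add: P_def)
    obtain y where "y \<in> vecs X" "sup_norm y = 1" "\<forall>i\<in>fst Ax \<union> {i. snd Ax i \<noteq> 0}. y i = 0"
      using ex[OF c] by blast
    then show "\<exists>By. P (Suc n) By \<and> R n Ax By"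
      using c by (intro exI[of _ "(fst Ax \<union> {i. snd Ax i \<noteq> 0}, y)"]) (simp add: P_def R_def)
  qed
  then obtain f where f: "\<And>n. P n (f n)" "\<And>n. R n (f n) (f (Suc n))" by blast
  define A where "A n = fst (f n)" for n
  define x where "x n = snd (f n)" for n
  have step: "A n \<union> {i. x n i \<noteq> 0} \<subseteq> A (Suc n)" for n using f(2)[of n] by (simp add: R_def A_def x_def)
  have mono: "A m \<subseteq> A n" if "m \<le> n" for m n
    by (rule lift_Suc_mono_le[OF _ that]) (use step in \<open>simp add: Un_subset_iff\<close>)
  have less: "x k i = 0" if "j < k" "x j i \<noteq> 0" for j k i
  proof -
    have "i \<in> A (Suc j)" using step[of j] that by blast
    then have "i \<in> A k" using mono[of "Suc j" k] that by auto
    then show ?thesis using f(1)[of k] by (simp add: P_def A_def x_def)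
  qed
  show False
  proof (rule reflexive_no_disjoint_sequence[OF refl])
    show "x n \<in> vecs X" "sup_norm (x n) = 1" for n using f(1)[of n] by (simp_all add: P_def x_def)
    show "j = k" if "x j i \<noteq> 0" "x k i \<noteq> 0" for j k i
      using less[of j k i] less[of k j i] that by (cases j k rule: linorder_cases) auto
  qed
qed

end

section \<open>The equivalences and the reflexive case\<close>

theorem theorem2p1:
  fixes \<Gamma> :: "'g set"
  shows
    "(\<forall>X :: ('g, 'k::{real_normed_field, euclidean_space}) fspace.
        closed_subspace X (linf_c \<Gamma>) \<and> WLD TYPE('d) X \<longrightarrow>
          (separable X \<longleftrightarrow> embeds X linf) \<and>
          (separable X \<longleftrightarrow> injects X linf) \<and>
          (separable X \<longleftrightarrow> \<not> (\<exists>Y. closed_subspace Y X \<and> isomorphic Y (c0 omega1))) \<and>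
          (separable X \<longleftrightarrow> \<not> (\<exists>Y. closed_subspace Y X \<and> isometrically_isomorphic Y (c0 omega1)))) \<and>
     (\<forall>X :: ('g, 'k) fspace.
        closed_subspace X (linf_c \<Gamma>) \<and> reflexive X \<longrightarrow> separable X)"
proof (intro conjI allI impI)
  fix X :: "('g, 'k) fspace"
  assume X: "closed_subspace X (linf_c \<Gamma>) \<and> reflexive X"
  then interpret linf_c_subspace X \<Gamma> by unfold_locales blast
  show "separable X" using X reflexive_imp_separable by blast
next
  fix X :: "('g, 'k) fspace"
  assume X: "closed_subspace X (linf_c \<Gamma>) \<and> WLD TYPE('d) X"
  then interpret linf_c_subspace X \<Gamma> by unfold_locales blast
  \<comment> \<open>The implications \<open>1\<close> to \<open>5\<close> form a cycle through all
    five conditions, in the order separable, embedding, injection, no isomorphic copy, no isometric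
    copy, and back to separable. Only the last one uses the WLD hypothesis.\<close>
  note 1 = separable_imp_embeds_linf
  note 2 = embeds_linf_imp_injects_linf
  have 3: "\<not> (\<exists>Y. closed_subspace Y X \<and> isomorphic Y (c0 omega1))" if "injects X (linf :: (nat, 'k) fspace)"
    using countable_if_injects_linf_and_contains_c0[OF that] uncountable_omega1 by blast
  have 4: "\<not> (\<exists>Y. closed_subspace Y X \<and> isometrically_isomorphic Y (c0 omega1))"
    if "\<not> (\<exists>Y. closed_subspace Y X \<and> isomorphic Y (c0 omega1))"
  proof
    assume "\<exists>Y. closed_subspace Y X \<and> isometrically_isomorphic Y (c0 omega1)"
    then obtain Y where Y: "closed_subspace Y X" "isometrically_isomorphic Y (c0 omega1)" by blast
    have "isomorphic Y (c0 omega1)"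
      by (rule isometrically_isomorphic_imp_isomorphic[OF Y(2)])
        (use Y(1) in \<open>auto simp: closed_subspace_def\<close>)
    then show False using that Y(1) by blast
  qed
  have 5: "separable X" if "\<not> (\<exists>Y. closed_subspace Y X \<and> isometrically_isomorphic Y (c0 omega1))"
    using WLD_nonseparable_contains_c0 X that by blast
  show "separable X \<longleftrightarrow> embeds X linf" using 1 2 3 4 5 by argo
  show "separable X \<longleftrightarrow> injects X linf" using 1 2 3 4 5 by argo
  show "separable X \<longleftrightarrow> \<not> (\<exists>Y. closed_subspace Y X \<and> isomorphic Y (c0 omega1))" using 1 2 3 4 5 by argo
  show "separable X \<longleftrightarrow> \<not> (\<exists>Y. closed_subspace Y X \<and> isometrically_isomorphic Y (c0 omega1))" using 1 2 3 4 5 by argo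
qed

end
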